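(* Let $n,m\ge 1$ be integers, let $A_1,\dots,A_m$ be positive $n\times n$ complex matrices, let $Z_1,\dots,Z_m$ be expansive $n\times n$ complex matrices, and let $f:[0,\infty)\to[0,\infty)$ be a concave function. Then, for all symmetric norms $\|\cdot\|$ on the $n\times n$ complex matrices, $$ \left\|f\left(\sum_{i=1}^m Z_i^*A_iZ_i\right) \right\| \le \left\| \sum_{i=1}^m Z_i^*f(A_i)Z_i \right\|. $$
   Context: "Positive" means positive semidefinite (Hermitian), written $A\ge 0$. A matrix $Z$ is called expansive if $Z^*Z\ge I$, i.e. $Z^*Z-I$ is positive semidefinite. A symmetric (or unitarily invariant) norm is a norm $\|\cdot\|$ on the space of $n\times n$ complex matrices such that $\|A\|=\|UAV\|$ for all matrices $A$ and all unitaries $U,V$. For a positive matrix $A$, $f(A)$ is defined by the functional calculus (applying $f$ to the eigenvalues of $A$ in a spectral decomposition). *)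

theory Defs
  imports "HOL-Analysis.Analysis"
begin

definition conj_transpose :: "complex^'n^'m \<Rightarrow> complex^'m^'n" where
  "conj_transpose A = map_matrix cnj (transpose A)"

definition unitary_matrix :: "complex^'n^'n \<Rightarrow> bool" where
  "unitary_matrix U \<longleftrightarrow>
     conj_transpose U ** U = mat 1 \<and> U ** conj_transpose U = mat 1"

definition hermitian_matrix :: "complex^'n^'n \<Rightarrow> bool" where
  "hermitian_matrix A \<longleftrightarrow> conj_transpose A = A"

text \<open>For Hermitian A the number \<open>x\<^sup>* A x\<close> is real, so taking real parts loses nothing.\<close>

definition psd_matrix :: "complex^'n^'n \<Rightarrow> bool" where
  "psd_matrix A \<longleftrightarrow>
     hermitian_matrix A \<and> (\<forall>x. 0 \<le> Re (\<Sum>i\<in>UNIV. cnj (x $ i) * (A *v x) $ i))"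

definition expansive_matrix :: "complex^'n^'n \<Rightarrow> bool" where
  "expansive_matrix Z \<longleftrightarrow> psd_matrix (conj_transpose Z ** Z - mat 1)"

definition matrix_norm :: "(complex^'n^'n \<Rightarrow> real) \<Rightarrow> bool" where
  "matrix_norm N \<longleftrightarrow>
     (\<forall>A. 0 \<le> N A) \<and>
     (\<forall>A. N A = 0 \<longleftrightarrow> A = 0) \<and>
     (\<forall>c A. N (map_matrix ((*) c) A) = cmod c * N A) \<and>
     (\<forall>A B. N (A + B) \<le> N A + N B)"

definition symmetric_norm :: "(complex^'n^'n \<Rightarrow> real) \<Rightarrow> bool" where
  "symmetric_norm N \<longleftrightarrow>
     matrix_norm N \<and>
     (\<forall>A U V. unitary_matrix U \<longrightarrow> unitary_matrix V \<longrightarrow> N (U ** A ** V) = N A)"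

definition real_diag :: "('n \<Rightarrow> real) \<Rightarrow> complex^'n^'n" where
  "real_diag d = (\<chi> i j. if i = j then complex_of_real (d i) else 0)"

definition is_matrix_fun :: "(real \<Rightarrow> real) \<Rightarrow> complex^'n^'n \<Rightarrow> complex^'n^'n \<Rightarrow> bool" where
  "is_matrix_fun f A B \<longleftrightarrow>
     (\<exists>U d. unitary_matrix U \<and>
        A = U ** real_diag d ** conj_transpose U \<and>
        B = U ** real_diag (\<lambda>i. f (d i)) ** conj_transpose U)"

text \<open>The value does not depend on the spectral decomposition chosen
  (\<open>is_matrix_fun_unique\<close>). It is meaningful for Hermitian A only; otherwise A has no such
  decomposition and the value is unspecified. Only the values of f at eigenvalues of A matter.\<close>

definition matrix_fun :: "(real \<Rightarrow> real) \<Rightarrow> complex^'n^'n \<Rightarrow> complex^'n^'n" where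
  "matrix_fun f A = (THE B. is_matrix_fun f A B)"

lemma real_diag_mult_right: "(W ** real_diag d) $ i $ j = W $ i $ j * complex_of_real (d j)"
proof -
  have "(W ** real_diag d) $ i $ j
      = (\<Sum>k\<in>UNIV. if k = j then W $ i $ k * complex_of_real (d k) else 0)"
    unfolding matrix_matrix_mult_def real_diag_def by (simp add: if_distrib cong: if_cong)
  then show ?thesis by simp
qed

lemma real_diag_mult_left: "(real_diag d ** W) $ i $ j = complex_of_real (d i) * W $ i $ j"
proof -
  have "(real_diag d ** W) $ i $ j
      = (\<Sum>k\<in>UNIV. if i = k then complex_of_real (d i) * W $ k $ j else 0)"
    unfolding matrix_matrix_mult_def real_diag_def vec_lambda_beta
    by (rule sum.cong) auto
  then show ?thesis by simp
qed

lemma is_matrix_fun_unique: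
  assumes "is_matrix_fun f A B" "is_matrix_fun f A C"
  shows "B = C"
proof -
  obtain U d where U: "unitary_matrix U" "A = U ** real_diag d ** conj_transpose U"
      "B = U ** real_diag (\<lambda>i. f (d i)) ** conj_transpose U"
    using assms(1) unfolding is_matrix_fun_def by blast
  obtain V e where V: "unitary_matrix V" "A = V ** real_diag e ** conj_transpose V"
      "C = V ** real_diag (\<lambda>i. f (e i)) ** conj_transpose V"
    using assms(2) unfolding is_matrix_fun_def by blast
  note uU = U(1)[unfolded unitary_matrix_def] and uV = V(1)[unfolded unitary_matrix_def]
  define W where "W = conj_transpose V ** U"
  have "conj_transpose V ** A ** U = W ** real_diag d"
    unfolding U(2) W_def using uU by (metis matrix_mul_assoc matrix_mul_rid)
  moreover have "conj_transpose V ** A ** U = real_diag e ** W"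
    unfolding V(2) W_def using uV by (metis matrix_mul_assoc matrix_mul_lid)
  ultimately have "W ** real_diag d = real_diag e ** W" by simp
  then have eq: "W $ i $ j * complex_of_real (d j) = complex_of_real (e i) * W $ i $ j" for i j
    by (metis real_diag_mult_left real_diag_mult_right)
  have "W $ i $ j * complex_of_real (f (d j)) = complex_of_real (f (e i)) * W $ i $ j" for i j
    using eq[of i j] by (cases "W $ i $ j = 0") auto
  then have "W ** real_diag (\<lambda>i. f (d i)) = real_diag (\<lambda>i. f (e i)) ** W"
    by (simp add: vec_eq_iff real_diag_mult_left real_diag_mult_right)
  then have "V ** (W ** real_diag (\<lambda>i. f (d i))) ** conj_transpose U
      = V ** (real_diag (\<lambda>i. f (e i)) ** W) ** conj_transpose U" by simp
  moreover have "V ** (W ** real_diag (\<lambda>i. f (d i))) ** conj_transpose U = B"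
    unfolding U(3) W_def using uV by (metis matrix_mul_assoc matrix_mul_lid)
  moreover have "V ** (real_diag (\<lambda>i. f (e i)) ** W) ** conj_transpose U = C"
    unfolding V(3) W_def using uU by (metis matrix_mul_assoc matrix_mul_rid)
  ultimately show ?thesis by simp
qed

lemma matrix_fun_eqI: "is_matrix_fun f A B \<Longrightarrow> matrix_fun f A = B"
  unfolding matrix_fun_def using is_matrix_fun_unique by (blast intro: the_equality)

end

theory Submission
  imports Defs
begin

text \<open>
Write \<open>S\<close> for the sum of the \<open>Z\<^sub>i\<^sup>* A\<^sub>i Z\<^sub>i\<close> and \<open>Y\<close> for the sum of the \<open>Z\<^sub>i\<^sup>* f(A\<^sub>i) Z\<^sub>i\<close>. By Ky Fan's dominance theorem
(\<open>ky_fan_dominance\<close>) the norm inequality follows if, for every \<open>k\<close>, the \<open>k\<close> largest eigenvalues of \<open>f(S)\<close> have a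
sum not exceeding that of the \<open>k\<close> largest eigenvalues of \<open>Y\<close>. As \<open>f\<close> is nondecreasing, the former belong to eigenvectors
\<open>w\<^sub>j\<close> of the \<open>k\<close> largest eigenvalues \<open>s\<^sub>j\<close> of \<open>S\<close>, and by the maximum principle it is enough to show that the sum of the \<open>f(s\<^sub>j)\<close> is at most the sum of the \<open>w\<^sub>j \<bullet> Y w\<^sub>j\<close>.

The vectors \<open>w\<^sub>j\<close> depend only on \<open>S\<close>, so this inequality is additive in \<open>f\<close>. On the finitely many eigenvalues involved, \<open>f\<close>
agrees with \<open>f(0) + b t\<close> minus a nonnegative combination of the functions \<open>(t - a)\<^sub>+\<close> with \<open>a \<ge> 0\<close>
(\<open>concave_hinge_interpolation\<close>). The affine part is harmless, because \<open>f(0) \<ge> 0\<close> and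
the \<open>Z\<^sub>i\<close> are expansive. What remains is the reverse inequality for a single hinge function (\<open>hinge_trace_le\<close>).

With \<open>T\<close> the sum of the \<open>Z\<^sub>i\<^sup>* (A\<^sub>i - a)\<^sub>+ Z\<^sub>i\<close>, the point is that one can add \<open>a\<close> to each of the
largest positive eigenvalues of \<open>T\<close> and still stay below \<open>S\<close>. The function
\<open>t + a \<cdot> 1(t > 0)\<close> is a left inverse of \<open>(t - a)\<^sub>+\<close> on the set \<open>{0} \<union> {t. t > a}\<close>, and, being the identity plus a
multiple of the support, it is a limit of operator monotone functions. The support is subadditive in the required sense: if \<open>T\<close> is a sum
of positive matrices \<open>B\<^sub>i\<close>, then on the span of eigenvectors of \<open>T\<close> for its largest positive eigenvalues the range
projections of the \<open>B\<^sub>i\<close> have total trace at least the dimension (\<open>card_le_trace_of_ranges\<close>). Expansiveness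
makes \<open>Z\<^sub>i\<^sup>* P\<^sub>i Z\<^sub>i\<close> dominate the range projection of \<open>Z\<^sub>i\<^sup>* (A\<^sub>i - a)\<^sub>+ Z\<^sub>i\<close>, where \<open>P\<^sub>i\<close> is the spectral projection of
\<open>A\<^sub>i\<close> above \<open>a\<close> (\<open>congruence_range_bound\<close>).
\<close>

section \<open>Adjoints and the real inner product\<close>

definition cinner :: "complex^'n \<Rightarrow> complex^'n \<Rightarrow> complex" where
  "cinner x y = (\<Sum>i\<in>UNIV. cnj (x $ i) * y $ i)"

lemma inner_eq_Re_cinner: "x \<bullet> y = Re (cinner x y)"
  by (simp add: cinner_def inner_vec_def inner_complex_def)

lemma conj_transpose_nth: "conj_transpose A $ i $ j = cnj (A $ j $ i)"
  by (simp add: conj_transpose_def map_matrix_def transpose_def)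

lemma conj_transpose_conj_transpose [simp]: "conj_transpose (conj_transpose A) = A"
  by (simp add: vec_eq_iff conj_transpose_nth)

lemma conj_transpose_mult: "conj_transpose (A ** B) = conj_transpose B ** conj_transpose A"
  by (simp add: vec_eq_iff conj_transpose_nth matrix_matrix_mult_def mult.commute)

lemma conj_transpose_sum: "conj_transpose (\<Sum>i\<in>I. A i) = (\<Sum>i\<in>I. conj_transpose (A i))"
  by (simp add: vec_eq_iff conj_transpose_nth)

lemma conj_transpose_real_diag [simp]: "conj_transpose (real_diag d) = real_diag d"
  by (simp add: vec_eq_iff conj_transpose_nth real_diag_def)

lemma cinner_adjoint: "cinner x (A *v y) = cinner (conj_transpose A *v x) y"
proof -
  have "cinner x (A *v y) = (\<Sum>i\<in>UNIV. \<Sum>j\<in>UNIV. cnj (x $ i) * (A $ i $ j * y $ j))"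
    by (simp add: cinner_def matrix_vector_mult_def sum_distrib_left)
  also have "\<dots> = (\<Sum>j\<in>UNIV. \<Sum>i\<in>UNIV. cnj (x $ i) * (A $ i $ j * y $ j))"
    by (rule sum.swap)
  also have "\<dots> = cinner (conj_transpose A *v x) y"
    by (simp add: cinner_def matrix_vector_mult_def conj_transpose_nth sum_distrib_left sum_distrib_right mult_ac)
  finally show ?thesis .
qed

lemma inner_adjoint: "x \<bullet> (A *v y) = (conj_transpose A *v x) \<bullet> y"
  by (simp add: inner_eq_Re_cinner cinner_adjoint)

lemma inner_adjoint_left: "(A *v x) \<bullet> y = x \<bullet> (conj_transpose A *v y)"
  by (simp add: inner_adjoint)

lemma norm_sq_vec: "(norm x)\<^sup>2 = (\<Sum>i\<in>UNIV. (cmod (x $ i))\<^sup>2)" for x :: "complex^'n"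
  by (simp add: norm_vec_def L2_set_def sum_nonneg)

lemma cinner_self: "cinner x x = complex_of_real ((norm x)\<^sup>2)"
  unfolding cinner_def norm_sq_vec of_real_sum
  by (rule sum.cong) (simp_all add: mult.commute complex_norm_square flip: of_real_power)

lemma cinner_add_right: "cinner x (y + z) = cinner x y + cinner x z"
  by (simp add: cinner_def algebra_simps sum.distrib)

lemma cinner_scaleR_right: "cinner x (c *\<^sub>R y) = complex_of_real c * cinner x y"
  unfolding cinner_def sum_distrib_left
  by (rule sum.cong) (simp_all add: scaleR_conv_of_real[where 'a = complex])

lemma cinner_scaleR_left: "cinner (c *\<^sub>R x) y = complex_of_real c * cinner x y"
  unfolding cinner_def sum_distrib_left
  by (rule sum.cong) (simp_all add: scaleR_conv_of_real[where 'a = complex])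

lemma matrix_vector_scaleR: "A *v (c *\<^sub>R x) = c *\<^sub>R (A *v x)" for A :: "complex^'n^'m"
  by (simp add: vec_eq_iff matrix_vector_mult_def scaleR_sum_right)

lemma cinner_commute: "cinner y x = cnj (cinner x y)"
  by (simp add: cinner_def mult.commute)

lemma psd_matrix_iff: "psd_matrix A \<longleftrightarrow> hermitian_matrix A \<and> (\<forall>x. 0 \<le> x \<bullet> (A *v x))"
  by (simp add: psd_matrix_def inner_eq_Re_cinner cinner_def)

section \<open>The spectral theorem\<close>

text \<open>
The quadratic form of \<open>A\<close> attains a maximum \<open>c\<close> on the compact unit sphere of \<open>V\<close>, at some \<open>v\<close>. Then
\<open>y \<bullet> (c y - A y)\<close> is nonnegative on \<open>V\<close> and vanishes at \<open>v\<close>; moving from \<open>v\<close> in the direction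
\<open>w = c v - A v\<close>, which stays in \<open>V\<close>, has first-order effect \<open>2 t (w \<bullet> w)\<close>, so \<open>w = 0\<close>.
\<close>

lemma invariant_subspace_eigenvector:
  fixes A :: "complex^'n^'n"
  assumes herm: "hermitian_matrix A"
    and sub: "subspace V" and inv: "\<And>x. x \<in> V \<Longrightarrow> A *v x \<in> V"
    and ne: "x0 \<in> V" "x0 \<noteq> 0"
  obtains v c where "v \<in> V" "norm v = 1" "A *v v = c *\<^sub>R v"
proof -
  let ?S = "V \<inter> sphere 0 1"
  have sym: "x \<bullet> (A *v y) = (A *v x) \<bullet> y" for x y
    using herm by (simp add: inner_adjoint hermitian_matrix_def)
  have "compact ?S"
    using closed_subspace[OF sub] by (intro closed_Int_compact) auto
  moreover have "x0 /\<^sub>R norm x0 \<in> ?S"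
    using ne sub by (auto simp: subspace_scale)
  moreover have "continuous_on ?S (\<lambda>x. x \<bullet> (A *v x))"
    by (intro continuous_intros matrix_vector_mult_linear_continuous_on)
  ultimately obtain v where v: "v \<in> ?S" and max: "\<And>y. y \<in> ?S \<Longrightarrow> y \<bullet> (A *v y) \<le> v \<bullet> (A *v v)"
    using continuous_attains_sup[of ?S "\<lambda>x. x \<bullet> (A *v x)"] by blast
  define c where "c = v \<bullet> (A *v v)"
  define w where "w = c *\<^sub>R v - A *v v"
  define q where "q y = y \<bullet> (c *\<^sub>R y - A *v y)" for y
  have vV: "v \<in> V" and nv: "norm v = 1" using v by auto
  have wV: "w \<in> V" unfolding w_def using vV inv sub by (simp add: subspace_diff subspace_scale)
  have q: "0 \<le> q y" if "y \<in> V" for y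
  proof (cases "y = 0")
    case False
    have "y /\<^sub>R norm y \<in> ?S" using False that sub by (auto simp: subspace_scale)
    from max[OF this] have "inverse (norm y) * (inverse (norm y) * (y \<bullet> (A *v y))) \<le> c"
      by (simp add: c_def matrix_vector_scaleR)
    then have "y \<bullet> (A *v y) / (norm y)\<^sup>2 \<le> c"
      by (simp add: power2_eq_square divide_inverse mult_ac)
    then show ?thesis
      using False by (simp add: q_def inner_diff_right field_simps power2_norm_eq_inner)
  qed (simp add: q_def)
  have qv: "q v = 0"
    using nv by (simp add: q_def c_def inner_diff_right norm_eq_1)
  have expand: "q (v + t *\<^sub>R w) = 2 * t * (w \<bullet> w) + t\<^sup>2 * q w" for t
  proof -
    have vw: "v \<bullet> w = 0" using qv by (simp add: q_def w_def)
    have sw: "v \<bullet> (c *\<^sub>R w - A *v w) = w \<bullet> w"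
    proof -
      have "v \<bullet> (c *\<^sub>R w - A *v w) = (c *\<^sub>R v - A *v v) \<bullet> w"
        by (simp only: inner_diff_left inner_diff_right inner_scaleR_left inner_scaleR_right sym)
      then show ?thesis by (simp only: w_def)
    qed
    have lin: "c *\<^sub>R (v + t *\<^sub>R w) - A *v (v + t *\<^sub>R w) = w + t *\<^sub>R (c *\<^sub>R w - A *v w)"
    proof -
      have "c *\<^sub>R (v + t *\<^sub>R w) - A *v (v + t *\<^sub>R w) = (c *\<^sub>R v - A *v v) + t *\<^sub>R (c *\<^sub>R w - A *v w)"
        by (simp add: matrix_vector_right_distrib matrix_vector_scaleR algebra_simps)
      then show ?thesis by (simp only: w_def)
    qed
    show ?thesis
      unfolding q_def lin inner_add_left inner_add_right inner_scaleR_left inner_scaleR_right sw vw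
      by (simp add: power2_eq_square algebra_simps)
  qed
  have "w \<bullet> w = 0"
  proof (rule ccontr)
    assume "w \<bullet> w \<noteq> 0"
    then have pos: "w \<bullet> w > 0" by (simp add: inner_gt_zero_iff)
    have qw: "q w \<ge> 0" using q wV by simp
    \<comment> \<open>Small enough for the linear term to win; the added \<open>1\<close> covers \<open>q w = 0\<close>.\<close>
    define t where "t = - (w \<bullet> w) / (q w + 1)"
    have "0 \<le> q (v + t *\<^sub>R w)"
      using q vV wV sub by (simp add: subspace_add subspace_scale)
    then have "0 \<le> t * (2 * (w \<bullet> w) + t * q w)"
      by (simp add: expand power2_eq_square algebra_simps)
    moreover have "t < 0" using pos qw by (simp add: t_def divide_neg_pos)
    moreover have "2 * (w \<bullet> w) + t * q w > 0"
    proof -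
      have "(w \<bullet> w) * q w \<le> (w \<bullet> w) * (q w + 1)" using pos by simp
      then have "(w \<bullet> w) * q w / (q w + 1) \<le> w \<bullet> w" using qw by (simp add: divide_le_eq)
      moreover have "t * q w = - ((w \<bullet> w) * q w / (q w + 1))" by (simp add: t_def)
      ultimately show ?thesis using pos by linarith
    qed
    ultimately show False by (metis mult_neg_pos not_le)
  qed
  then have "A *v v = c *\<^sub>R v" by (simp add: w_def)
  with vV nv that show ?thesis by blast
qed

text \<open>
Eigenvectors are added one at a time, each found in the orthogonal complement of the earlier ones, which
\<open>A\<close> leaves invariant. Indexing by subsets of the matrix index type makes the last stage directly the
columns of a square matrix.
\<close>

lemma hermitian_orthonormal_eigenvectors:
  fixes A :: "complex^'n^'n" and I :: "'n set"
  assumes herm: "hermitian_matrix A"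
  shows "\<exists>u d. (\<forall>i\<in>I. A *v u i = (d i::real) *\<^sub>R u i) \<and>
           (\<forall>i\<in>I. \<forall>j\<in>I. cinner (u i) (u j) = (if i = j then 1 else 0))"
proof -
  have "finite I" by simp
  then show ?thesis
  proof (induction I rule: finite_induct)
    case empty
    show ?case by simp
  next
    case (insert k I)
    then obtain u d where eig: "\<And>i. i \<in> I \<Longrightarrow> A *v u i = (d i::real) *\<^sub>R u i"
      and orth: "\<And>i j. i \<in> I \<Longrightarrow> j \<in> I \<Longrightarrow> cinner (u i) (u j) = (if i = j then 1 else 0)"
      by metis
    define V where "V = {x. \<forall>i\<in>I. cinner (u i) x = 0}"
    have sub: "subspace V"
      by (auto simp: subspace_def V_def cinner_add_right cinner_scaleR_right) (simp add: cinner_def)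
    have inv: "A *v x \<in> V" if "x \<in> V" for x
      using that herm eig by (auto simp: V_def cinner_adjoint hermitian_matrix_def cinner_scaleR_left)
    define B where "B = u ` I \<union> (\<lambda>i. \<i> *s u i) ` I"
    \<comment> \<open>Orthogonality of \<open>x\<close> to \<open>u\<close> in the complex sense is orthogonality to \<open>u\<close> and \<open>\<i> u\<close> in the real one,
      so the real dimension count has two vectors for each earlier eigenvector.\<close>
    have "dim B \<le> card B" by (rule dim_le_card') (simp add: B_def)
    also have "\<dots> \<le> card I + card I"
      unfolding B_def by (intro order_trans[OF card_Un_le] add_mono card_image_le) auto
    also have "\<dots> < DIM(complex^'n)"
    proof -
      have "card I < CARD('n)"
        using insert.hyps by (intro psubset_card_mono) auto
      then show ?thesis by simp
    qed
    finally obtain x where x: "x \<noteq> 0" "\<And>y. y \<in> span B \<Longrightarrow> orthogonal x y"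
      using orthogonal_to_subspace_exists by blast
    have "cinner (u i) x = 0" if "i \<in> I" for i
    proof -
      have "Re (cinner (u i) x) = 0"
        using x(2)[of "u i"] that span_base[of _ B]
        by (simp add: B_def orthogonal_def inner_commute flip: inner_eq_Re_cinner)
      moreover have "Re (cinner (\<i> *s u i) x) = 0"
        using x(2)[of "\<i> *s u i"] that span_base[of _ B]
        by (simp add: B_def orthogonal_def inner_commute flip: inner_eq_Re_cinner)
      moreover have "cinner (\<i> *s u i) x = - \<i> * cinner (u i) x"
        by (simp add: cinner_def sum_distrib_left mult_ac sum_negf)
      ultimately show ?thesis by (simp add: complex_eq_iff)
    qed
    then have "x \<in> V" by (simp add: V_def)
    then obtain v c where v: "v \<in> V" "norm v = 1" "A *v v = c *\<^sub>R v"
      using invariant_subspace_eigenvector[OF herm sub inv] x(1) by metis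
    have "\<forall>i\<in>insert k I. \<forall>j\<in>insert k I.
        cinner ((u(k := v)) i) ((u(k := v)) j) = (if i = j then 1 else 0)"
    proof -
      have "cinner v v = 1" "\<And>i. i \<in> I \<Longrightarrow> cinner (u i) v = 0" "\<And>i. i \<in> I \<Longrightarrow> cinner v (u i) = 0"
        using v by (simp_all add: cinner_self V_def cinner_commute[of v "u _"])
      then show ?thesis using insert.hyps orth by auto
    qed
    moreover have "\<forall>i\<in>insert k I. A *v (u(k := v)) i = (d(k := c)) i *\<^sub>R (u(k := v)) i"
      using v insert.hyps eig by auto
    ultimately show ?case by blast
  qed
qed

lemma hermitian_spectral_decomposition:
  fixes A :: "complex^'n^'n"
  assumes "hermitian_matrix A"
  obtains U d where "unitary_matrix U" "A = U ** real_diag d ** conj_transpose U"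
proof -
  obtain u :: "'n \<Rightarrow> complex^'n" and d where eig: "\<And>i. A *v u i = (d i::real) *\<^sub>R u i"
    and orth: "\<And>i j. cinner (u i) (u j) = (if i = j then 1 else 0)"
    using hermitian_orthonormal_eigenvectors[OF assms, of UNIV] by auto
  define U where "U = (\<chi> i j. u j $ i)"
  have 1: "conj_transpose U ** U = mat 1"
    using orth by (simp add: vec_eq_iff matrix_matrix_mult_def conj_transpose_nth U_def mat_def cinner_def)
  then have U: "unitary_matrix U"
    by (simp add: unitary_matrix_def matrix_left_right_inverse)
  have "(A ** U) $ i $ j = (U ** real_diag d) $ i $ j" for i j
  proof -
    have "(A ** U) $ i $ j = (A *v u j) $ i"
      by (simp add: matrix_matrix_mult_def matrix_vector_mult_def U_def)
    then show ?thesis by (simp add: eig real_diag_mult_right U_def mult.commute scaleR_conv_of_real[where 'a = complex])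
  qed
  then have "A ** U = U ** real_diag d" by (simp add: vec_eq_iff)
  then have "A ** (U ** conj_transpose U) = U ** real_diag d ** conj_transpose U"
    by (simp add: matrix_mul_assoc)
  with U that show ?thesis by (simp add: unitary_matrix_def)
qed

section \<open>Spectral matrices and unitary coordinates\<close>

definition spectral_matrix :: "complex^'n^'n \<Rightarrow> ('n \<Rightarrow> real) \<Rightarrow> complex^'n^'n" where
  "spectral_matrix U d = U ** real_diag d ** conj_transpose U"

lemma matrix_fun_spectral:
  "unitary_matrix U \<Longrightarrow> matrix_fun f (spectral_matrix U d) = spectral_matrix U (\<lambda>i. f (d i))"
  by (rule matrix_fun_eqI) (auto simp: is_matrix_fun_def spectral_matrix_def)

lemma hermitian_spectral_matrix: "hermitian_matrix (spectral_matrix U d)"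
  by (simp add: hermitian_matrix_def spectral_matrix_def conj_transpose_mult matrix_mul_assoc)

lemma spectral_matrix_mult:
  fixes U :: "complex^'n^'n"
  assumes "unitary_matrix U"
  shows "spectral_matrix U a ** spectral_matrix U b = spectral_matrix U (\<lambda>i. a i * b i)"
proof -
  have "real_diag a ** real_diag b = (real_diag (\<lambda>i. a i * b i) :: complex^'n^'n)"
    by (simp add: vec_eq_iff real_diag_mult_left) (simp add: real_diag_def)
  moreover have "spectral_matrix U a ** spectral_matrix U b
      = U ** (real_diag a ** (conj_transpose U ** U) ** real_diag b) ** conj_transpose U"
    by (simp add: spectral_matrix_def matrix_mul_assoc)
  ultimately show ?thesis
    using assms by (simp add: unitary_matrix_def spectral_matrix_def)
qed

lemma unitary_conj_transpose: "unitary_matrix U \<Longrightarrow> unitary_matrix (conj_transpose U)"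
  by (simp add: unitary_matrix_def)

lemma unitary_mult:
  assumes "unitary_matrix U" "unitary_matrix V" shows "unitary_matrix (U ** V)"
proof -
  have "conj_transpose V ** conj_transpose U ** (U ** V) = conj_transpose V ** (conj_transpose U ** U) ** V"
    and "U ** V ** (conj_transpose V ** conj_transpose U) = U ** (V ** conj_transpose V) ** conj_transpose U"
    by (simp_all add: matrix_mul_assoc)
  then show ?thesis using assms by (simp add: unitary_matrix_def conj_transpose_mult)
qed

lemma norm_unitary_mult:
  assumes "unitary_matrix U" shows "norm (U *v x) = norm x"
proof -
  have "(U *v x) \<bullet> (U *v x) = x \<bullet> x"
    using assms by (simp add: inner_adjoint matrix_vector_mul_assoc unitary_matrix_def)
  then show ?thesis by (simp add: norm_eq_sqrt_inner)
qed

lemma real_diag_mult_vector: "(real_diag d *v x) $ i = d i *\<^sub>R x $ i"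
proof -
  have "(real_diag d *v x) $ i
      = (\<Sum>j\<in>UNIV. if j = i then complex_of_real (d i) * x $ i else 0)"
    unfolding matrix_vector_mult_def real_diag_def vec_lambda_beta by (rule sum.cong) auto
  then show ?thesis by (simp add: scaleR_conv_of_real)
qed

lemma spectral_matrix_coord:
  assumes "unitary_matrix U"
  shows "(conj_transpose U *v (spectral_matrix U d *v x)) $ l = d l *\<^sub>R (conj_transpose U *v x) $ l"
proof -
  have "conj_transpose U *v (spectral_matrix U d *v x)
      = (conj_transpose U ** U) *v (real_diag d *v (conj_transpose U *v x))"
    by (simp add: spectral_matrix_def matrix_vector_mul_assoc matrix_mul_assoc)
  then have "conj_transpose U *v (spectral_matrix U d *v x) = real_diag d *v (conj_transpose U *v x)"
    using assms by (simp add: unitary_matrix_def)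
  then show ?thesis
    by (simp only: real_diag_mult_vector)
qed

lemma inner_unitary_coord:
  assumes "unitary_matrix U"
  shows "x \<bullet> y = (conj_transpose U *v x) \<bullet> (conj_transpose U *v y)"
  using assms by (simp add: inner_adjoint matrix_vector_mul_assoc unitary_matrix_def)

text \<open>
Everything below is phrased through quadratic forms, which in these coordinates are linear in the function
applied to the eigenvalues.
\<close>

lemma spectral_quadratic_form:
  assumes "unitary_matrix U"
  shows "x \<bullet> (spectral_matrix U d *v x) = (\<Sum>l\<in>UNIV. d l * (cmod ((conj_transpose U *v x) $ l))\<^sup>2)"
  unfolding inner_unitary_coord[OF assms, of x]
  by (simp add: inner_vec_def spectral_matrix_coord[OF assms] flip: power2_norm_eq_inner)

lemma column_mult: "column j (A ** B) = A *v column j B"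
  by (simp add: vec_eq_iff column_def matrix_matrix_mult_def matrix_vector_mult_def)

lemma unitary_column_norm:
  assumes "unitary_matrix M"
  shows "(\<Sum>l\<in>UNIV. (cmod (M $ l $ j))\<^sup>2) = 1"
proof -
  have "(conj_transpose M ** M) $ j $ j = 1"
    using assms by (simp add: unitary_matrix_def mat_def)
  moreover have "(conj_transpose M ** M) $ j $ j = complex_of_real (\<Sum>l\<in>UNIV. (cmod (M $ l $ j))\<^sup>2)"
    unfolding of_real_sum complex_norm_square matrix_matrix_mult_def
    by (simp add: conj_transpose_nth mult.commute)
  ultimately have "complex_of_real (\<Sum>l\<in>UNIV. (cmod (M $ l $ j))\<^sup>2) = 1"
    by simp
  then show ?thesis by (simp only: of_real_eq_1_iff)
qed

lemma unitary_row_norm: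
  "unitary_matrix M \<Longrightarrow> (\<Sum>j\<in>UNIV. (cmod (M $ l $ j))\<^sup>2) = 1"
  using unitary_column_norm[OF unitary_conj_transpose, of M l] by (simp add: conj_transpose_nth)

lemma norm_unitary_column: "unitary_matrix U \<Longrightarrow> norm (column j U) = 1"
  using norm_sq_vec[of "column j U"] unitary_column_norm[of U j]
    power2_eq_imp_eq[of "norm (column j U)" 1] by (simp add: column_def)

lemma spectral_column_coord:
  assumes "unitary_matrix U"
  shows "(conj_transpose U *v column j U) $ l = (if l = j then 1 else 0)"
  using assms by (simp flip: column_mult) (simp add: unitary_matrix_def column_def mat_def)

lemma spectral_quadratic_form_column:
  assumes "unitary_matrix U"
  shows "column j U \<bullet> (spectral_matrix U d *v column j U) = d j"
  by (simp add: spectral_quadratic_form[OF assms] spectral_column_coord[OF assms] if_distrib if_distribR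
    cong: if_cong)

lemma psd_spectral_iff:
  assumes "unitary_matrix U"
  shows "psd_matrix (spectral_matrix U d) \<longleftrightarrow> (\<forall>j. 0 \<le> d j)"
proof
  assume "psd_matrix (spectral_matrix U d)"
  then show "\<forall>j. 0 \<le> d j"
    unfolding psd_matrix_iff using spectral_quadratic_form_column[OF assms, of _ d] by metis
next
  assume "\<forall>j. 0 \<le> d j"
  then show "psd_matrix (spectral_matrix U d)"
    by (simp add: psd_matrix_iff hermitian_spectral_matrix spectral_quadratic_form[OF assms] sum_nonneg)
qed

section \<open>The trace over the largest eigenvalues\<close>

text \<open>
An index set that carries the \<open>card K\<close> largest values of \<open>d\<close>, with ties broken arbitrarily. The index type
of a matrix has no order, so such sets take the place of the usual decreasing enumeration of the eigenvalues.
\<close>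

definition top_set :: "('a \<Rightarrow> real) \<Rightarrow> 'a set \<Rightarrow> bool" where
  "top_set d K \<longleftrightarrow> (\<forall>j\<in>K. \<forall>l. l \<notin> K \<longrightarrow> d l \<le> d j)"

lemma top_set_exists:
  fixes d :: "'a::finite \<Rightarrow> real"
  assumes "k \<le> CARD('a)"
  shows "\<exists>K. card K = k \<and> top_set d K"
  using assms
proof (induction k)
  case 0
  show ?case by (intro exI[of _ "{}"]) (simp add: top_set_def)
next
  case (Suc k)
  then obtain K where K: "card K = k" "top_set d K" by auto
  then have "- K \<noteq> {}" using Suc.prems by (metis Compl_UNIV_eq Suc_n_not_le_n double_complement)
  then have "Max (d ` (- K)) \<in> d ` (- K)" by (intro Max_in) auto
  then obtain m where m: "m \<in> - K" "d m = Max (d ` (- K))" by (metis imageE)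
  have m': "d l \<le> d m" if "l \<in> - K" for l using that by (simp add: m(2))
  have "top_set d (insert m K)" using K(2) m(1) m' by (auto simp: top_set_def)
  moreover have "card (insert m K) = Suc k" using K(1) m(1) by simp
  ultimately show ?case by blast
qed

text \<open>
Weight lying outside \<open>K\<close> can be moved into \<open>K\<close>, where the weights leave enough room for it and where
every value of \<open>d\<close> is at least as large; the threshold is the smallest value that \<open>d\<close> takes on \<open>K\<close>.
\<close>

lemma weighted_sum_le_top_sum:
  fixes d w :: "'a::finite \<Rightarrow> real"
  assumes top: "top_set d K" and d: "\<And>l. 0 \<le> d l"
    and w: "\<And>l. 0 \<le> w l" "\<And>l. w l \<le> 1" and total: "sum w UNIV \<le> card K"
  shows "(\<Sum>l\<in>UNIV. d l * w l) \<le> sum d K"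
proof (cases "K = {}")
  case True
  then have "sum w UNIV = 0" using total w(1) sum_nonneg[of UNIV w] by simp
  then have "\<And>l. w l = 0" using w(1) by (simp add: sum_nonneg_eq_0_iff)
  then show ?thesis using True by simp
next
  case False
  define c where "c = Min (d ` K)"
  have c_le: "c \<le> d j" if "j \<in> K" for j using that by (simp add: c_def)
  have c: "c \<in> d ` K" unfolding c_def using False by (intro Min_in) auto
  have c0: "0 \<le> c" using c d by auto
  have le_c: "d l \<le> c" if "l \<notin> K" for l
    using c top that by (auto simp: top_set_def)
  have split: "sum g UNIV = sum g K + sum g (- K)" for g :: "'a \<Rightarrow> real"
    using sum.subset_diff[of K UNIV g] by (simp add: Compl_eq_Diff_UNIV)
  have "(\<Sum>l\<in>- K. d l * w l) \<le> (\<Sum>l\<in>- K. c * w l)"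
    using le_c w(1) by (intro sum_mono mult_right_mono) auto
  also have "\<dots> = c * sum w (- K)" by (simp add: sum_distrib_left)
  also have "\<dots> \<le> c * (card K - sum w K)"
    using total c0 by (intro mult_left_mono) (simp_all add: split[of w])
  also have "\<dots> = (\<Sum>l\<in>K. c * (1 - w l))" by (simp add: sum_subtractf flip: sum_distrib_left)
  also have "\<dots> \<le> (\<Sum>l\<in>K. d l * (1 - w l))"
    using c_le w(2) by (intro sum_mono mult_right_mono) auto
  finally show ?thesis
    by (simp add: split algebra_simps sum_subtractf)
qed

text \<open>
The squared moduli of the entries of a unitary matrix form a doubly stochastic array, so their sums over a
set of columns are admissible weights.
\<close>

lemma unitary_weighted_sum_le_top_sum:
  assumes M: "unitary_matrix M" and top: "top_set d J" and d: "\<And>l. 0 \<le> d l"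
    and card: "card K \<le> card J"
  shows "(\<Sum>j\<in>K. \<Sum>l\<in>UNIV. d l * (cmod (M $ l $ j))\<^sup>2) \<le> sum d J"
proof -
  define w where "w l = (\<Sum>j\<in>K. (cmod (M $ l $ j))\<^sup>2)" for l
  have w: "0 \<le> w l" "w l \<le> 1" for l
    using unitary_row_norm[OF M, of l] sum_mono2[of UNIV K "\<lambda>j. (cmod (M $ l $ j))\<^sup>2"]
    by (simp_all add: w_def sum_nonneg)
  have "sum w UNIV = (\<Sum>j\<in>K. \<Sum>l\<in>UNIV. (cmod (M $ l $ j))\<^sup>2)"
    unfolding w_def by (rule sum.swap)
  then have "sum w UNIV \<le> card J" using card by (simp add: unitary_column_norm[OF M])
  then have "(\<Sum>l\<in>UNIV. d l * w l) \<le> sum d J"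
    by (rule weighted_sum_le_top_sum[OF top d w])
  moreover have "(\<Sum>l\<in>UNIV. d l * w l) = (\<Sum>j\<in>K. \<Sum>l\<in>UNIV. d l * (cmod (M $ l $ j))\<^sup>2)"
    unfolding w_def sum_distrib_left by (rule sum.swap)
  ultimately show ?thesis by simp
qed

text \<open>
One half of Ky Fan's maximum principle, for compressions to orthonormal families.
\<close>

lemma ky_fan_trace_le:
  assumes U: "unitary_matrix U" and W: "unitary_matrix W"
    and "top_set d J" "\<And>l. 0 \<le> d l" "card K \<le> card J"
  shows "(\<Sum>j\<in>K. column j W \<bullet> (spectral_matrix U d *v column j W)) \<le> sum d J"
proof -
  have "(conj_transpose U *v column j W) $ l = (conj_transpose U ** W) $ l $ j" for j l
    by (simp flip: column_mult) (simp add: column_def)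
  then show ?thesis
    using unitary_weighted_sum_le_top_sum[OF unitary_mult[OF unitary_conj_transpose[OF U] W] assms(3-5)]
    by (simp add: spectral_quadratic_form[OF U])
qed

section \<open>Counting eigenvectors by the ranges of the summands\<close>

text \<open>
The factorization \<open>X = B ** G\<close> records that the square root has its range inside the range of \<open>B\<close>.
\<close>

lemma psd_square_root:
  fixes B :: "complex^'n^'n"
  assumes "psd_matrix B"
  obtains X G where "hermitian_matrix X" "X ** X = B" "X = B ** G"
proof -
  obtain V b where V: "unitary_matrix V" and "B = V ** real_diag b ** conj_transpose V"
    using assms hermitian_spectral_decomposition unfolding psd_matrix_def by metis
  then have B: "B = spectral_matrix V b" by (simp add: spectral_matrix_def)
  have b: "0 \<le> b j" for j using assms psd_spectral_iff[OF V] by (simp add: B)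
  define X where "X = spectral_matrix V (\<lambda>j. sqrt (b j))"
  define G where "G = spectral_matrix V (\<lambda>j. inverse (sqrt (b j)))"
  have "b j * inverse (sqrt (b j)) = sqrt (b j)" for j
    using real_sqrt_mult_self[of "b j"] b[of j] by (cases "b j = 0") (auto simp: field_simps)
  then have "X = B ** G" by (simp add: X_def B G_def spectral_matrix_mult[OF V])
  moreover have "X ** X = B" using b by (simp add: X_def B spectral_matrix_mult[OF V])
  moreover have "hermitian_matrix X" by (simp add: X_def hermitian_spectral_matrix)
  ultimately show ?thesis using that by blast
qed

lemma hermitian_entries_cmod:
  "hermitian_matrix X \<Longrightarrow> cmod (X $ l $ j) = cmod (X $ j $ l)"
  by (metis hermitian_matrix_def conj_transpose_nth complex_mod_cnj)

text \<open>
Let \<open>T = spectral_matrix U t\<close>, let \<open>X\<close> be the square root of \<open>B\<close> and let \<open>M\<close> be the matrix of \<open>X\<close> in the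
eigenbasis of \<open>T\<close>. The left-hand side is the sum of \<open>|M\<^sub>l\<^sub>j|\<^sup>2 / t\<^sub>j\<close> over \<open>j \<in> J\<close> and all \<open>l\<close>. Replacing \<open>t\<^sub>j\<close> by
\<open>t\<^sub>l\<close> only increases it: the terms with \<open>l \<in> J\<close> are merely permuted, because \<open>|M\<^sub>l\<^sub>j| = |M\<^sub>j\<^sub>l|\<close>, and for \<open>l \<notin> J\<close> the
eigenvalue \<open>t\<^sub>l\<close> is at most \<open>t\<^sub>j\<close>. After the replacement the inner sum is the quadratic form of \<open>X T\<^sup>+ X\<close>, with \<open>T\<^sup>+\<close>
the pseudo-inverse, and \<open>B \<le> T\<close> bounds that operator by the projection onto the range of \<open>B\<close>. The
hypothesis \<open>range\<close> says in terms of vectors that \<open>R\<close> dominates this projection.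

The convention \<open>inverse 0 = 0\<close> makes \<open>\<lambda>l. inverse (t l)\<close> the spectrum of the pseudo-inverse.
\<close>

lemma summand_trace_bound:
  fixes B R U :: "complex^'n^'n"
  assumes U: "unitary_matrix U" and psd: "psd_matrix B" and t: "\<And>l. 0 \<le> t l"
    and B_le: "\<And>x. x \<bullet> (B *v x) \<le> x \<bullet> (spectral_matrix U t *v x)"
    and top: "top_set t J" and R_pos: "\<And>v. 0 \<le> v \<bullet> (R *v v)"
    and range: "\<And>v z. (v \<bullet> (B *v z))\<^sup>2 \<le> v \<bullet> (R *v v) * (norm (B *v z))\<^sup>2"
  shows "(\<Sum>j\<in>J. (column j U \<bullet> (B *v column j U)) / t j) \<le> (\<Sum>j\<in>J. column j U \<bullet> (R *v column j U))"
proof -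
  obtain X G where X: "hermitian_matrix X" and XX: "X ** X = B" and XG: "X = B ** G"
    using psd_square_root[OF psd] by blast
  have symX: "x \<bullet> (X *v y) = (X *v x) \<bullet> y" for x y
    using X by (simp add: inner_adjoint hermitian_matrix_def)
  have BX: "x \<bullet> (B *v x) = (norm (X *v x))\<^sup>2" for x
    by (simp add: symX power2_norm_eq_inner flip: XX matrix_vector_mul_assoc)
  define M where "M = conj_transpose U ** X ** U"
  have M_herm: "hermitian_matrix M"
    using X by (simp add: M_def hermitian_matrix_def conj_transpose_mult matrix_mul_assoc)
  have M_coord: "(conj_transpose U *v (X *v column j U)) $ l = M $ l $ j" for j l
    by (simp add: M_def flip: matrix_mul_assoc column_mult) (simp add: column_def)
  have norm_X: "(norm (X *v column j U))\<^sup>2 = (\<Sum>l\<in>UNIV. (cmod (M $ l $ j))\<^sup>2)" for j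
    using norm_unitary_mult[OF unitary_conj_transpose[OF U], of "X *v column j U"]
    by (simp add: norm_sq_vec[of "conj_transpose U *v _", symmetric] M_coord flip: norm_sq_vec M_coord)
  have M_zero: "M $ l $ j = 0" if "t l = 0" for l j
  proof -
    have "(norm (X *v column l U))\<^sup>2 \<le> 0"
      using B_le[of "column l U"] that by (simp add: BX spectral_quadratic_form_column[OF U])
    then have "X *v column l U = 0" by simp
    then have "M $ j $ l = 0" using M_coord[of l j] by simp
    then show ?thesis using hermitian_entries_cmod[OF M_herm, of l j] by simp
  qed
  \<comment> \<open>The operator inequality \<open>X T\<^sup>+ X \<le> R\<close>, tested on \<open>u\<close>. With \<open>w = T\<^sup>+ X u\<close> the number \<open>\<alpha> = X u \<bullet> w\<close>
    equals \<open>w \<bullet> T w\<close>, so it dominates \<open>|X w|\<^sup>2\<close>; it is also \<open>u \<bullet> X w\<close>, and \<open>X w\<close> lies in the range of \<open>B\<close>.\<close>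
  have single: "(\<Sum>l\<in>UNIV. inverse (t l) * (cmod (M $ l $ j))\<^sup>2) \<le> column j U \<bullet> (R *v column j U)" for j
  proof -
    define u where "u = column j U"
    define w where "w = spectral_matrix U (\<lambda>l. inverse (t l)) *v (X *v u)"
    define \<alpha> where "\<alpha> = (X *v u) \<bullet> w"
    have \<alpha>: "\<alpha> = (\<Sum>l\<in>UNIV. inverse (t l) * (cmod (M $ l $ j))\<^sup>2)"
      by (simp add: \<alpha>_def w_def spectral_quadratic_form[OF U] u_def M_coord)
    have "(norm (X *v w))\<^sup>2 \<le> w \<bullet> (spectral_matrix U t *v w)"
      using B_le[of w] by (simp add: BX)
    also have "\<dots> = (\<Sum>l\<in>UNIV. t l * (inverse (t l) * cmod (M $ l $ j))\<^sup>2)"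
      using t by (simp add: spectral_quadratic_form[OF U] w_def spectral_matrix_coord[OF U] u_def M_coord)
    also have "\<dots> = \<alpha>"
      unfolding \<alpha> by (intro sum.cong) (simp_all add: power2_eq_square field_simps)
    finally have Xw: "(norm (X *v w))\<^sup>2 \<le> \<alpha>" .
    have Ru: "0 \<le> u \<bullet> (R *v u)" by (rule R_pos)
    have "\<alpha>\<^sup>2 \<le> u \<bullet> (R *v u) * (norm (X *v w))\<^sup>2"
      using range[of u "G *v w"] by (simp add: \<alpha>_def matrix_vector_mul_assoc flip: XG symX)
    also have "\<dots> \<le> u \<bullet> (R *v u) * \<alpha>" by (intro mult_left_mono Xw Ru)
    finally have "\<alpha> * \<alpha> \<le> u \<bullet> (R *v u) * \<alpha>" by (simp add: power2_eq_square)
    then have "\<alpha> \<le> u \<bullet> (R *v u)"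
      using Ru by (cases "\<alpha> \<le> 0") (auto dest: mult_right_le_imp_le)
    then show ?thesis by (simp add: \<alpha> u_def)
  qed
  have "(\<Sum>j\<in>J. (column j U \<bullet> (B *v column j U)) / t j)
      = (\<Sum>j\<in>J. \<Sum>l\<in>UNIV. inverse (t j) * (cmod (M $ l $ j))\<^sup>2)"
    by (simp add: BX norm_X sum_distrib_left divide_inverse mult.commute)
  also have "\<dots> = (\<Sum>j\<in>J. \<Sum>l\<in>J. inverse (t j) * (cmod (M $ l $ j))\<^sup>2)
      + (\<Sum>j\<in>J. \<Sum>l\<in>- J. inverse (t j) * (cmod (M $ l $ j))\<^sup>2)"
    by (simp add: sum.subset_diff[of J UNIV] Compl_eq_Diff_UNIV sum.distrib)
  also have "\<dots> \<le> (\<Sum>j\<in>J. \<Sum>l\<in>J. inverse (t l) * (cmod (M $ l $ j))\<^sup>2)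
      + (\<Sum>j\<in>J. \<Sum>l\<in>- J. inverse (t l) * (cmod (M $ l $ j))\<^sup>2)"
  proof (rule add_mono)
    have "(\<Sum>j\<in>J. \<Sum>l\<in>J. inverse (t j) * (cmod (M $ l $ j))\<^sup>2)
        = (\<Sum>l\<in>J. \<Sum>j\<in>J. inverse (t j) * (cmod (M $ l $ j))\<^sup>2)" by (rule sum.swap)
    also have "\<dots> = (\<Sum>j\<in>J. \<Sum>l\<in>J. inverse (t l) * (cmod (M $ l $ j))\<^sup>2)"
      by (simp add: hermitian_entries_cmod[OF M_herm, of _ _])
    finally show "(\<Sum>j\<in>J. \<Sum>l\<in>J. inverse (t j) * (cmod (M $ l $ j))\<^sup>2)
        \<le> (\<Sum>j\<in>J. \<Sum>l\<in>J. inverse (t l) * (cmod (M $ l $ j))\<^sup>2)" by simp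
  next
    show "(\<Sum>j\<in>J. \<Sum>l\<in>- J. inverse (t j) * (cmod (M $ l $ j))\<^sup>2)
        \<le> (\<Sum>j\<in>J. \<Sum>l\<in>- J. inverse (t l) * (cmod (M $ l $ j))\<^sup>2)"
    proof (intro sum_mono)
      fix j l assume j: "j \<in> J" and l: "l \<in> - J"
      show "inverse (t j) * (cmod (M $ l $ j))\<^sup>2 \<le> inverse (t l) * (cmod (M $ l $ j))\<^sup>2"
      proof (cases "t l = 0")
        case False
        then have "inverse (t j) \<le> inverse (t l)"
          using t[of l] top j l by (intro le_imp_inverse_le) (auto simp: top_set_def)
        then show ?thesis by (intro mult_right_mono) auto
      qed (simp add: M_zero)
    qed
  qed
  also have "\<dots> = (\<Sum>j\<in>J. \<Sum>l\<in>UNIV. inverse (t l) * (cmod (M $ l $ j))\<^sup>2)"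
    by (simp add: sum.subset_diff[of J UNIV] Compl_eq_Diff_UNIV sum.distrib)
  also have "\<dots> \<le> (\<Sum>j\<in>J. column j U \<bullet> (R *v column j U))"
    by (intro sum_mono single)
  finally show ?thesis .
qed

lemma matrix_sum_vector: "(\<Sum>i\<in>I. A i) *v x = (\<Sum>i\<in>I. A i *v x)"
  for A :: "'i \<Rightarrow> complex^'n^'m"
  by (induction I rule: infinite_finite_induct) (simp_all add: matrix_vector_mult_add_rdistrib)

text \<open>
A localized subadditivity of the rank: if \<open>J\<close> collects all positive eigenvalues and the \<open>R\<^sub>i\<close> are the range
projections, it says that the rank of a sum is at most the sum of the ranks. Each of the \<open>card J\<close> units is written as
\<open>(u \<bullet> T u) / t\<^sub>j\<close> for an eigenvector \<open>u\<close>, and \<open>T\<close> is distributed over its summands.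
\<close>

lemma card_le_trace_of_ranges:
  fixes B R :: "'i \<Rightarrow> complex^'n^'n" and U :: "complex^'n^'n"
  assumes U: "unitary_matrix U" and T: "spectral_matrix U t = (\<Sum>i\<in>I. B i)" and fin: "finite I"
    and psd: "\<And>i. i \<in> I \<Longrightarrow> psd_matrix (B i)"
    and top: "top_set t J" and pos: "\<And>j. j \<in> J \<Longrightarrow> 0 < t j"
    and R_pos: "\<And>i v. i \<in> I \<Longrightarrow> 0 \<le> v \<bullet> (R i *v v)"
    and range: "\<And>i v z. i \<in> I \<Longrightarrow> (v \<bullet> (B i *v z))\<^sup>2 \<le> v \<bullet> (R i *v v) * (norm (B i *v z))\<^sup>2"
  shows "card J \<le> (\<Sum>j\<in>J. \<Sum>i\<in>I. column j U \<bullet> (R i *v column j U))"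
proof -
  have T_form: "x \<bullet> (spectral_matrix U t *v x) = (\<Sum>i\<in>I. x \<bullet> (B i *v x))" for x
    by (simp add: T matrix_sum_vector inner_sum_right)
  have B_pos: "0 \<le> x \<bullet> (B i *v x)" if "i \<in> I" for i x
    using psd[OF that] by (simp add: psd_matrix_iff)
  have t: "0 \<le> t l" for l
    using T_form[of "column l U"] B_pos by (simp add: spectral_quadratic_form_column[OF U] sum_nonneg)
  have "card J = (\<Sum>j\<in>J. column j U \<bullet> (spectral_matrix U t *v column j U) / t j)"
    using pos by (simp add: spectral_quadratic_form_column[OF U] less_imp_neq[symmetric])
  also have "\<dots> = (\<Sum>i\<in>I. \<Sum>j\<in>J. (column j U \<bullet> (B i *v column j U)) / t j)"
    unfolding T_form sum_divide_distrib by (rule sum.swap)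
  also have "\<dots> \<le> (\<Sum>i\<in>I. \<Sum>j\<in>J. column j U \<bullet> (R i *v column j U))"
  proof (rule sum_mono)
    fix i assume i: "i \<in> I"
    have "x \<bullet> (B i *v x) \<le> x \<bullet> (spectral_matrix U t *v x)" for x
      unfolding T_form using member_le_sum[OF i, of "\<lambda>i. x \<bullet> (B i *v x)"] B_pos fin by auto
    then show "(\<Sum>j\<in>J. (column j U \<bullet> (B i *v column j U)) / t j)
        \<le> (\<Sum>j\<in>J. column j U \<bullet> (R i *v column j U))"
      using psd[OF i] t top R_pos[OF i] range[OF i] by (intro summand_trace_bound U) auto
  qed
  also have "\<dots> = (\<Sum>j\<in>J. \<Sum>i\<in>I. column j U \<bullet> (R i *v column j U))" by (rule sum.swap)
  finally show ?thesis .
qed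

text \<open>
An expansive square matrix is injective, hence surjective. This is what turns \<open>Z\<^sup>* Z \<ge> 1\<close> into \<open>Z Z\<^sup>* \<ge> 1\<close>.
\<close>

lemma expansive_norm_conj_transpose:
  assumes "expansive_matrix Z"
  shows "norm y \<le> norm (conj_transpose Z *v y)"
proof -
  have Z: "norm x \<le> norm (Z *v x)" for x
  proof -
    have "0 \<le> x \<bullet> ((conj_transpose Z ** Z - mat 1) *v x)"
      using assms by (simp add: expansive_matrix_def psd_matrix_iff)
    also have "\<dots> = (Z *v x) \<bullet> (Z *v x) - x \<bullet> x"
      by (simp add: matrix_vector_mult_diff_rdistrib inner_diff_right inner_adjoint_left
        flip: matrix_vector_mul_assoc)
    finally show ?thesis by (simp add: norm_eq_sqrt_inner)
  qed
  have "x = 0" if "Z *v x = 0" for x using Z[of x] that by simp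
  then obtain W where "W ** Z = mat 1" using matrix_left_invertible_ker by blast
  then have "Z ** W = mat 1" by (simp add: matrix_left_right_inverse)
  then obtain x where y: "y = Z *v x"
    by (metis matrix_vector_mul_assoc matrix_vector_mul_lid)
  have "norm y * norm y = x \<bullet> (conj_transpose Z *v y)"
    by (simp add: y inner_adjoint flip: power2_eq_square power2_norm_eq_inner)
  also have "\<dots> \<le> norm x * norm (conj_transpose Z *v y)" by (rule norm_cauchy_schwarz)
  also have "\<dots> \<le> norm y * norm (conj_transpose Z *v y)"
    by (intro mult_right_mono) (simp_all add: y Z)
  finally show ?thesis by (cases "y = 0") auto
qed

lemma psd_congruence:
  assumes "psd_matrix A"
  shows "psd_matrix (conj_transpose Z ** A ** Z)"
proof -
  have "x \<bullet> ((conj_transpose Z ** A ** Z) *v x) = (Z *v x) \<bullet> (A *v (Z *v x))" for x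
    by (simp add: inner_adjoint_left flip: matrix_vector_mul_assoc)
  moreover have "hermitian_matrix (conj_transpose Z ** A ** Z)"
    using assms by (simp add: psd_matrix_def hermitian_matrix_def conj_transpose_mult matrix_mul_assoc)
  ultimately show ?thesis using assms by (simp add: psd_matrix_iff)
qed

lemma psd_sum: "(\<And>i. i \<in> I \<Longrightarrow> psd_matrix (A i)) \<Longrightarrow> psd_matrix (\<Sum>i\<in>I. A i)"
  for A :: "'i \<Rightarrow> complex^'n^'n"
  by (simp add: psd_matrix_iff hermitian_matrix_def conj_transpose_sum matrix_sum_vector
      inner_sum_right sum_nonneg)

section \<open>Hinge functions under expansive congruences\<close>

lemma congruence_quadratic_form:
  assumes "unitary_matrix V"
  shows "x \<bullet> ((conj_transpose Z ** spectral_matrix V g ** Z) *v x)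
    = (\<Sum>k\<in>UNIV. g k * (cmod ((conj_transpose V *v (Z *v x)) $ k))\<^sup>2)"
proof -
  have "x \<bullet> ((conj_transpose Z ** spectral_matrix V g ** Z) *v x)
      = (Z *v x) \<bullet> (spectral_matrix V g *v (Z *v x))"
    by (simp add: inner_adjoint_left flip: matrix_vector_mul_assoc)
  then show ?thesis by (simp add: spectral_quadratic_form[OF assms])
qed

text \<open>
With \<open>P\<close> the projection \<open>spectral_matrix V p\<close> and \<open>C = spectral_matrix V g = P C\<close>, the matrix \<open>Z\<^sup>* P Z\<close> dominates the
projection onto the range of \<open>Z\<^sup>* C Z\<close>. The inner product on the left is that of \<open>P Z v\<close> with \<open>C Z z\<close>; apply
Cauchy-Schwarz and then expansiveness of \<open>Z\<^sup>*\<close> to the second factor.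
\<close>

lemma congruence_range_bound:
  assumes V: "unitary_matrix V" and Z: "expansive_matrix Z"
    and p: "\<And>k. p k * p k = p k" "\<And>k. p k * g k = g k"
  shows "(v \<bullet> ((conj_transpose Z ** spectral_matrix V g ** Z) *v z))\<^sup>2
    \<le> v \<bullet> ((conj_transpose Z ** spectral_matrix V p ** Z) *v v)
      * (norm ((conj_transpose Z ** spectral_matrix V g ** Z) *v z))\<^sup>2"
proof -
  let ?P = "spectral_matrix V p" and ?C = "spectral_matrix V g"
  let ?y = "?C *v (Z *v z)" and ?x = "?P *v (Z *v v)"
  have P: "x \<bullet> (?P *v y) = (?P *v x) \<bullet> y" for x y
    using hermitian_spectral_matrix[of V p] by (simp add: inner_adjoint hermitian_matrix_def)
  have PP: "?P *v (?P *v x) = ?P *v x" and PC: "?P *v (?C *v x) = ?C *v x" for x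
    by (simp_all add: matrix_vector_mul_assoc spectral_matrix_mult[OF V] p)
  have "v \<bullet> ((conj_transpose Z ** ?C ** Z) *v z) = (Z *v v) \<bullet> (?P *v ?y)"
    by (simp add: PC inner_adjoint_left flip: matrix_vector_mul_assoc)
  then have 1: "v \<bullet> ((conj_transpose Z ** ?C ** Z) *v z) = ?x \<bullet> ?y" by (simp only: P)
  have "v \<bullet> ((conj_transpose Z ** ?P ** Z) *v v) = (Z *v v) \<bullet> (?P *v ?x)"
    by (simp add: PP inner_adjoint_left flip: matrix_vector_mul_assoc)
  then have 2: "v \<bullet> ((conj_transpose Z ** ?P ** Z) *v v) = ?x \<bullet> ?x" by (simp only: P)
  have 3: "norm ?y \<le> norm ((conj_transpose Z ** ?C ** Z) *v z)"
    using expansive_norm_conj_transpose[OF Z, of ?y] by (simp flip: matrix_vector_mul_assoc)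
  have "(?x \<bullet> ?y)\<^sup>2 \<le> (?x \<bullet> ?x) * (norm ?y)\<^sup>2"
    using Cauchy_Schwarz_ineq[of ?x ?y] by (simp add: power2_norm_eq_inner)
  also have "\<dots> \<le> (?x \<bullet> ?x) * (norm ((conj_transpose Z ** ?C ** Z) *v z))\<^sup>2"
    by (intro mult_left_mono power_mono 3) auto
  finally show ?thesis by (simp only: 1 2)
qed

text \<open>
The inequality for the convex functions \<open>\<lambda>t. max (t - a) 0\<close>, in which the roles of the two sides are reversed.
Let \<open>C\<^sub>i = (A\<^sub>i - a)\<^sub>+\<close>, let \<open>P\<^sub>i\<close> be the spectral projection of \<open>A\<^sub>i\<close> above \<open>a\<close>, and let \<open>T\<close> be the sum of the
\<open>Z\<^sub>i\<^sup>* C\<^sub>i Z\<^sub>i\<close>. The trace of \<open>T\<close> over any \<open>card K\<close> orthonormal vectors is at most the sum of its largest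
eigenvalues, and only the positive ones, say those in \<open>J'\<close>, matter. On their eigenvectors the
\<open>Z\<^sub>i\<^sup>* P\<^sub>i Z\<^sub>i\<close> contribute at least \<open>card J'\<close>, and \<open>C\<^sub>i + a P\<^sub>i \<le> A\<^sub>i\<close>, so the sum of these
eigenvalues of \<open>T\<close> plus \<open>a * card J'\<close> is at most the trace of \<open>S\<close> over the same eigenvectors. Moving
\<open>a * card J'\<close> to the other side leaves a trace of \<open>S - a\<close>, to which the maximum principle applies again.
\<close>

lemma hinge_trace_le:
  fixes Z V :: "'i \<Rightarrow> complex^'n^'n" and W :: "complex^'n^'n"
  assumes fin: "finite I" and W: "unitary_matrix W"
    and S: "spectral_matrix W s = (\<Sum>i\<in>I. conj_transpose (Z i) ** spectral_matrix (V i) (d i) ** Z i)"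
    and V: "\<And>i. i \<in> I \<Longrightarrow> unitary_matrix (V i)" and d: "\<And>i k. i \<in> I \<Longrightarrow> 0 \<le> d i k"
    and Z: "\<And>i. i \<in> I \<Longrightarrow> expansive_matrix (Z i)"
    and a: "0 \<le> a" and top: "top_set s K"
  shows "(\<Sum>j\<in>K. \<Sum>i\<in>I. column j W \<bullet>
           ((conj_transpose (Z i) ** spectral_matrix (V i) (\<lambda>k. max (d i k - a) 0) ** Z i) *v column j W))
         \<le> (\<Sum>j\<in>K. max (s j - a) 0)"
proof -
  define B where "B i = conj_transpose (Z i) ** spectral_matrix (V i) (\<lambda>k. max (d i k - a) 0) ** Z i" for i
  define R where "R i = conj_transpose (Z i) ** spectral_matrix (V i) (\<lambda>k. if a < d i k then 1 else 0) ** Z i" for i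
  have B_psd: "psd_matrix (B i)" if "i \<in> I" for i
    unfolding B_def by (intro psd_congruence) (simp add: psd_spectral_iff V that)
  have R_pos: "0 \<le> x \<bullet> (R i *v x)" if "i \<in> I" for i x
    unfolding R_def congruence_quadratic_form[OF V[OF that]] by (intro sum_nonneg) auto
  have range: "(v \<bullet> (B i *v z))\<^sup>2 \<le> v \<bullet> (R i *v v) * (norm (B i *v z))\<^sup>2" if "i \<in> I" for i v z
    unfolding B_def R_def by (intro congruence_range_bound V Z that) auto
  have psd: "psd_matrix (\<Sum>i\<in>I. B i)" by (intro psd_sum B_psd)
  then obtain U t where U: "unitary_matrix U" and T: "spectral_matrix U t = (\<Sum>i\<in>I. B i)"
    unfolding spectral_matrix_def psd_matrix_def by (metis hermitian_spectral_decomposition)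
  have t: "0 \<le> t l" for l using psd psd_spectral_iff[OF U, of t] by (simp add: T)
  have T_form: "(\<Sum>i\<in>I. x \<bullet> (B i *v x)) = x \<bullet> (spectral_matrix U t *v x)" for x
    by (simp add: T matrix_sum_vector inner_sum_right)
  have "card K \<le> CARD('n)" by (intro card_mono) auto
  then obtain J where J: "card J = card K" "top_set t J" using top_set_exists by blast
  define J' where "J' = {j \<in> J. 0 < t j}"
  have top': "top_set t J'"
    using J(2) unfolding top_set_def J'_def by force
  have card': "card J' \<le> card K"
    unfolding J(1)[symmetric] by (intro card_mono) (auto simp: J'_def)
  have "sum t J = sum t J'"
    using t by (intro sum.mono_neutral_right) (auto simp: J'_def order_le_less)
  then have "(\<Sum>j\<in>K. \<Sum>i\<in>I. column j W \<bullet> (B i *v column j W)) \<le> sum t J'"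
    unfolding T_form using ky_fan_trace_le[OF U W J(2) t, of K] J(1) by simp
  also have "\<dots> \<le> (\<Sum>j\<in>J'. column j U \<bullet> (spectral_matrix W s *v column j U) - a)"
  proof -
    have "card J' \<le> (\<Sum>j\<in>J'. \<Sum>i\<in>I. column j U \<bullet> (R i *v column j U))"
      using B_psd top' R_pos range by (intro card_le_trace_of_ranges[OF U T fin]) (auto simp: J'_def)
    then have "sum t J' + a * card J'
        \<le> sum t J' + a * (\<Sum>j\<in>J'. \<Sum>i\<in>I. column j U \<bullet> (R i *v column j U))"
      using a by (intro add_left_mono mult_left_mono)
    also have "\<dots> = (\<Sum>j\<in>J'. \<Sum>i\<in>I. column j U \<bullet> (B i *v column j U) + a * (column j U \<bullet> (R i *v column j U)))"
      by (simp add: sum.distrib T_form spectral_quadratic_form_column[OF U] sum_distrib_left)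
    also have "\<dots> \<le> (\<Sum>j\<in>J'. \<Sum>i\<in>I. column j U \<bullet>
        ((conj_transpose (Z i) ** spectral_matrix (V i) (d i) ** Z i) *v column j U))"
    proof (intro sum_mono)
      fix j i assume i: "i \<in> I"
      show "column j U \<bullet> (B i *v column j U) + a * (column j U \<bullet> (R i *v column j U)) \<le> column j U \<bullet>
        ((conj_transpose (Z i) ** spectral_matrix (V i) (d i) ** Z i) *v column j U)"
        unfolding B_def R_def congruence_quadratic_form[OF V[OF i]] sum_distrib_left sum.distrib[symmetric]
      proof (rule sum_mono)
        fix k
        let ?q = "(cmod ((conj_transpose (V i) *v (Z i *v column j U)) $ k))\<^sup>2"
        have "max (d i k - a) 0 * ?q + a * ((if a < d i k then 1 else 0) * ?q)
            = (max (d i k - a) 0 + a * (if a < d i k then 1 else 0)) * ?q" by (simp add: algebra_simps)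
        also have "\<dots> \<le> d i k * ?q" using d[OF i] by (intro mult_right_mono) auto
        finally show "max (d i k - a) 0 * ?q + a * ((if a < d i k then 1 else 0) * ?q) \<le> d i k * ?q" .
      qed
    qed
    also have "\<dots> = (\<Sum>j\<in>J'. column j U \<bullet> (spectral_matrix W s *v column j U))"
      by (simp add: S matrix_sum_vector inner_sum_right)
    finally show ?thesis by (simp add: sum_subtractf mult.commute)
  qed
  also have "\<dots> \<le> (\<Sum>j\<in>J'. column j U \<bullet> (spectral_matrix W (\<lambda>l. max (s l - a) 0) *v column j U))"
  proof (rule sum_mono)
    fix j
    let ?q = "\<lambda>l. (cmod ((conj_transpose W *v column j U) $ l))\<^sup>2"
    have "sum ?q UNIV = 1"
      using norm_unitary_mult[OF unitary_conj_transpose[OF W], of "column j U"]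
      by (simp add: norm_unitary_column[OF U] flip: norm_sq_vec)
    then have "column j U \<bullet> (spectral_matrix W s *v column j U) - a = (\<Sum>l\<in>UNIV. s l * ?q l) - a * sum ?q UNIV"
      by (simp add: spectral_quadratic_form[OF W])
    also have "\<dots> = (\<Sum>l\<in>UNIV. (s l - a) * ?q l)"
      by (simp add: sum_distrib_left left_diff_distrib sum_subtractf)
    also have "\<dots> \<le> (\<Sum>l\<in>UNIV. max (s l - a) 0 * ?q l)"
      by (intro sum_mono mult_right_mono) auto
    finally show "column j U \<bullet> (spectral_matrix W s *v column j U) - a
        \<le> column j U \<bullet> (spectral_matrix W (\<lambda>l. max (s l - a) 0) *v column j U)"
      by (simp add: spectral_quadratic_form[OF W])
  qed
  also have "\<dots> \<le> (\<Sum>j\<in>K. max (s j - a) 0)"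
    using top card' by (intro ky_fan_trace_le W U) (force simp: top_set_def)+
  finally show ?thesis by (simp add: B_def)
qed

section \<open>Concave functions on finitely many points\<close>

lemma concave_on_three_points:
  fixes f :: "real \<Rightarrow> real"
  assumes f: "concave_on {0..} f" and "0 \<le> x" "x \<le> y" "y \<le> z"
  shows "(z - y) * f x + (y - x) * f z \<le> (z - x) * f y"
proof (cases "x = z")
  case False
  then have xz: "x < z" using assms by simp
  define u where "u = (y - x) / (z - x)"
  have u: "0 \<le> u" "u \<le> 1" "u * (z - x) = y - x" using assms xz by (simp_all add: u_def)
  have y: "(1 - u) *\<^sub>R x + u *\<^sub>R z = y" using u(3) by (simp add: algebra_simps)
  have "(1 - u) * f x + u * f z \<le> f y"
    using concave_onD[OF f u(1,2), of x z] assms by (simp only: y) auto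
  then have "(z - x) * ((1 - u) * f x + u * f z) \<le> (z - x) * f y"
    using xz by (intro mult_left_mono) auto
  moreover have "(z - x) * ((1 - u) * f x + u * f z) = (z - x - u * (z - x)) * f x + u * (z - x) * f z"
    by (simp add: algebra_simps)
  ultimately show ?thesis by (simp add: u(3))
qed (use assms in auto)

text \<open>
The interpolating function is extended from left to right. Beyond its last knot it is affine and lies above
\<open>f\<close>, so a new value of \<open>f\<close> is met by bending it downwards at the previous point; concavity keeps it above \<open>f\<close> further
on. The first piece is the chord from \<open>0\<close>, which is why \<open>0\<close> is kept out of \<open>D\<close>: a concave function
may have an infinite slope or a jump there, so no tangent could be used.
\<close>

lemma concave_hinge_interpolation_positive:
  fixes f :: "real \<Rightarrow> real"
  assumes f: "concave_on {0..} f" and D: "finite D" "D \<noteq> {}" "D \<subseteq> {0<..}"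
  shows "\<exists>b A c. finite A \<and> A \<subseteq> {0..<Max D} \<and> (\<forall>a\<in>A. 0 \<le> c a) \<and>
    (\<forall>t\<in>D. f t = f 0 + b * t - (\<Sum>a\<in>A. c a * max (t - a) 0)) \<and>
    (\<forall>t\<ge>Max D. f t \<le> f 0 + b * t - (\<Sum>a\<in>A. c a * max (t - a) 0))"
  using D
proof (induction D rule: finite_linorder_max_induct)
  case empty
  then show ?case by simp
next
  case (insert y D)
  have y: "0 < y" using insert.prems by simp
  show ?case
  proof (cases "D = {}")
    case True
    have "f t \<le> f 0 + (f y - f 0) / y * t" if "y \<le> t" for t
      using concave_on_three_points[OF f, of 0 y t] y that by (simp add: field_simps)
    then show ?thesis using y True
      by (intro exI[of _ "(f y - f 0) / y"] exI[of _ "{}"]) auto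
  next
    case False
    define m where "m = Max D"
    have m: "m \<in> D" "\<And>t. t \<in> D \<Longrightarrow> t \<le> m" using False insert.hyps(1) by (simp_all add: m_def)
    have my: "0 < m" "m < y" using m(1) insert.hyps(2) insert.prems by auto
    have Max: "Max (insert y D) = y"
      using insert.hyps False my by (simp add: m_def)
    have "D \<subseteq> {0<..}" using insert.prems by simp
    from insert.IH[OF False this, folded m_def]
    obtain b A c where A: "finite A" "A \<subseteq> {0..<m}" "\<And>a. a \<in> A \<Longrightarrow> 0 \<le> c a"
      and eq: "\<And>t. t \<in> D \<Longrightarrow> f t = f 0 + b * t - (\<Sum>a\<in>A. c a * max (t - a) 0)"
      and le: "\<And>t. m \<le> t \<Longrightarrow> f t \<le> f 0 + b * t - (\<Sum>a\<in>A. c a * max (t - a) 0)"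
      by blast
    define g where "g t = f 0 + b * t - (\<Sum>a\<in>A. c a * max (t - a) 0)" for t
    define \<gamma> where "\<gamma> = (g y - f y) / (y - m)"
    define A' where "A' = insert m A"
    define c' where "c' = c(m := \<gamma>)"
    have \<gamma>: "0 \<le> \<gamma>" using le[of y] my by (simp add: \<gamma>_def g_def)
    have "m \<notin> A" using A(2) by auto
    then have g': "f 0 + b * t - (\<Sum>a\<in>A'. c' a * max (t - a) 0) = g t - \<gamma> * max (t - m) 0" for t
    proof -
      have "(\<Sum>a\<in>A. c' a * max (t - a) 0) = (\<Sum>a\<in>A. c a * max (t - a) 0)"
        using \<open>m \<notin> A\<close> by (intro sum.cong) (auto simp: c'_def)
      then show ?thesis using \<open>m \<notin> A\<close> A(1) by (simp add: A'_def g_def c'_def)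
    qed
    have affine: "g t = g m + (t - m) * (b - sum c A)" if "m \<le> t" for t
    proof -
      have "(\<Sum>a\<in>A. c a * max (t - a) 0) = (\<Sum>a\<in>A. c a * max (m - a) 0 + c a * (t - m))"
        using A(2) that by (intro sum.cong) (auto simp: max_def algebra_simps)
      also have "\<dots> = (\<Sum>a\<in>A. c a * max (m - a) 0) + sum c A * (t - m)"
        by (simp add: sum.distrib sum_distrib_right)
      finally show ?thesis by (simp add: g_def algebra_simps)
    qed
    have fm: "f m = g m" using eq m(1) by (simp add: g_def)
    have "\<gamma> * (y - m) = g y - f y" using my by (simp add: \<gamma>_def)
    then have fy: "f y = g m + (y - m) * (b - sum c A - \<gamma>)"
      using affine[of y] my by (simp add: algebra_simps)
    have above: "f t \<le> g t - \<gamma> * max (t - m) 0" if "y \<le> t" for t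
    proof -
      have "(y - m) * f t \<le> (t - m) * f y - (t - y) * g m"
        using concave_on_three_points[OF f, of m y t] my that by (simp add: fm)
      also have "\<dots> = (y - m) * (g m + (t - m) * (b - sum c A - \<gamma>))"
        unfolding fy by (simp add: algebra_simps)
      finally have "f t \<le> g m + (t - m) * (b - sum c A - \<gamma>)"
        using my by simp
      then show ?thesis using affine[of t] my that by (simp add: algebra_simps)
    qed
    have at_knots: "f t = g t - \<gamma> * max (t - m) 0" if "t \<in> insert y D" for t
      using that affine[of y] my fy m(2)[of t] eq[of t] by (auto simp: g_def[symmetric] algebra_simps)
    have "finite A'" "A' \<subseteq> {0..<y}" "\<forall>a\<in>A'. 0 \<le> c' a"
      using A my \<gamma> by (auto simp: A'_def c'_def)
    then show ?thesis
      unfolding Max using at_knots above by (intro exI[of _ b] exI[of _ A'] exI[of _ c']) (simp add: g')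
  qed
qed

lemma concave_hinge_interpolation:
  fixes f :: "real \<Rightarrow> real"
  assumes f: "concave_on {0..} f" and D: "finite D" "D \<subseteq> {0..}"
  obtains b A c where "finite A" "\<And>a. a \<in> A \<Longrightarrow> 0 \<le> a" "\<And>a. a \<in> A \<Longrightarrow> 0 \<le> c a"
    "\<And>t. t \<in> D \<Longrightarrow> f t = f 0 + b * t - (\<Sum>a\<in>A. c a * max (t - a) 0)"
proof (cases "D - {0} = {}")
  case True
  then show ?thesis using that[of "{}" "\<lambda>_. 0" 0] by auto
next
  case False
  have "finite (D - {0})" "D - {0} \<subseteq> {0<..}" using D by auto
  from concave_hinge_interpolation_positive[OF f this(1) False this(2)]
  obtain b A c where A: "finite A" "A \<subseteq> {0..<Max (D - {0})}" "\<forall>a\<in>A. 0 \<le> c a"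
    and eq: "\<forall>t\<in>D - {0}. f t = f 0 + b * t - (\<Sum>a\<in>A. c a * max (t - a) 0)"
    by blast
  have "f t = f 0 + b * t - (\<Sum>a\<in>A. c a * max (t - a) 0)" if "t \<in> D" for t
  proof (cases "t = 0")
    case True
    have "(\<Sum>a\<in>A. c a * max (t - a) 0) = 0" using A(2) True by (intro sum.neutral) auto
    then show ?thesis using True by simp
  qed (use eq that in auto)
  moreover have "0 \<le> a" if "a \<in> A" for a using A(2) that by auto
  ultimately show ?thesis using that[of A c b] A by blast
qed

text \<open>
The right-hand side is linear in the function applied to the \<open>A\<^sub>i\<close>, and only finitely many values of \<open>f\<close> enter.
So \<open>f\<close> may be replaced by a combination of the constant \<open>1\<close>, the identity, and hinges with nonpositive
coefficients. The identity gives equality, the constant gives \<open>card K\<close> on the left and, by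
expansiveness, at least that much on the right, and the hinges satisfy the reverse inequality.
\<close>

lemma concave_trace_ge:
  fixes Z V :: "'i \<Rightarrow> complex^'n^'n" and W :: "complex^'n^'n" and f :: "real \<Rightarrow> real"
  assumes fin: "finite I" and ne: "I \<noteq> {}" and W: "unitary_matrix W" and s: "\<And>j. 0 \<le> s j"
    and S: "spectral_matrix W s = (\<Sum>i\<in>I. conj_transpose (Z i) ** spectral_matrix (V i) (d i) ** Z i)"
    and V: "\<And>i. i \<in> I \<Longrightarrow> unitary_matrix (V i)" and d: "\<And>i k. i \<in> I \<Longrightarrow> 0 \<le> d i k"
    and Z: "\<And>i. i \<in> I \<Longrightarrow> expansive_matrix (Z i)"
    and f: "concave_on {0..} f" and f0: "0 \<le> f 0" and top: "top_set s K"
  shows "(\<Sum>j\<in>K. f (s j)) \<le> (\<Sum>j\<in>K. \<Sum>i\<in>I. column j W \<bullet>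
           ((conj_transpose (Z i) ** spectral_matrix (V i) (\<lambda>k. f (d i k)) ** Z i) *v column j W))"
proof -
  define p where "p j i k = (cmod ((conj_transpose (V i) *v (Z i *v column j W)) $ k))\<^sup>2" for j i k
  define L where "L g = (\<Sum>j\<in>K. \<Sum>i\<in>I. \<Sum>k\<in>UNIV. g (d i k) * p j i k)" for g :: "real \<Rightarrow> real"
  have L: "L g = (\<Sum>j\<in>K. \<Sum>i\<in>I. column j W \<bullet>
           ((conj_transpose (Z i) ** spectral_matrix (V i) (\<lambda>k. g (d i k)) ** Z i) *v column j W))" for g
    unfolding L_def p_def by (intro sum.cong refl congruence_quadratic_form[OF V, symmetric])
  have L_id: "L (\<lambda>t. t) = sum s K"
    by (simp add: L flip: inner_sum_right matrix_sum_vector S) (simp add: spectral_quadratic_form_column[OF W])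
  have L_one: "card K \<le> L (\<lambda>t. 1)"
  proof -
    obtain i0 where i0: "i0 \<in> I" using ne by blast
    have p_sum: "1 \<le> (\<Sum>k\<in>UNIV. p j i k)" if i: "i \<in> I" for i j
    proof -
      have "0 \<le> column j W \<bullet> ((conj_transpose (Z i) ** Z i - mat 1) *v column j W)"
        using Z[OF i] by (simp add: expansive_matrix_def psd_matrix_iff)
      also have "\<dots> = (norm (Z i *v column j W))\<^sup>2 - (norm (column j W))\<^sup>2"
        by (simp add: matrix_vector_mult_diff_rdistrib inner_diff_right inner_adjoint_left power2_norm_eq_inner
          flip: matrix_vector_mul_assoc)
      finally show ?thesis
        using norm_unitary_mult[OF unitary_conj_transpose[OF V[OF i]], of "Z i *v column j W"]
        by (simp add: p_def norm_unitary_column[OF W] flip: norm_sq_vec)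
    qed
    have "1 \<le> (\<Sum>i\<in>I. \<Sum>k\<in>UNIV. p j i k)" for j
      using p_sum[OF i0, of j] member_le_sum[OF i0, of "\<lambda>i. \<Sum>k\<in>UNIV. p j i k"] fin
      by (fastforce simp: p_def sum_nonneg)
    then have "(\<Sum>j\<in>K. 1) \<le> (\<Sum>j\<in>K. \<Sum>i\<in>I. \<Sum>k\<in>UNIV. p j i k)" by (intro sum_mono)
    then show ?thesis by (simp add: L_def)
  qed
  define D where "D = s ` K \<union> (\<Union>i\<in>I. range (d i))"
  have D: "finite D" "D \<subseteq> {0..}" using fin s d by (auto simp: D_def)
  obtain b A c where A: "finite A" "\<And>a. a \<in> A \<Longrightarrow> 0 \<le> a" "\<And>a. a \<in> A \<Longrightarrow> 0 \<le> c a"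
    and eq: "\<And>t. t \<in> D \<Longrightarrow> f t = f 0 + b * t - (\<Sum>a\<in>A. c a * max (t - a) 0)"
    by (rule concave_hinge_interpolation[OF f D]) blast
  have "L f = L (\<lambda>t. f 0 + b * t - (\<Sum>a\<in>A. c a * max (t - a) 0))"
    unfolding L_def by (intro sum.cong refl) (subst eq, auto simp: D_def)
  also have "\<dots> = f 0 * L (\<lambda>t. 1) + b * L (\<lambda>t. t) - L (\<lambda>t. \<Sum>a\<in>A. c a * max (t - a) 0)"
    by (simp add: L_def sum.distrib sum_subtractf sum_distrib_left algebra_simps)
  also have "L (\<lambda>t. \<Sum>a\<in>A. c a * max (t - a) 0) = (\<Sum>a\<in>A. c a * L (\<lambda>t. max (t - a) 0))"
    by (simp add: L_def sum_distrib_left sum_distrib_right mult.assoc sum.swap[of _ A])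
  finally have Lf: "L f = f 0 * L (\<lambda>t. 1) + b * sum s K - (\<Sum>a\<in>A. c a * L (\<lambda>t. max (t - a) 0))"
    by (simp only: L_id)
  have "(\<Sum>j\<in>K. f (s j)) = (\<Sum>j\<in>K. f 0 + b * s j - (\<Sum>a\<in>A. c a * max (s j - a) 0))"
    by (intro sum.cong refl eq) (simp add: D_def)
  also have "\<dots> = f 0 * card K + b * sum s K - (\<Sum>a\<in>A. c a * (\<Sum>j\<in>K. max (s j - a) 0))"
    by (simp add: sum.distrib sum_subtractf sum_distrib_left sum.swap[of _ A] mult.commute)
  also have "\<dots> \<le> f 0 * L (\<lambda>t. 1) + b * sum s K - (\<Sum>a\<in>A. c a * L (\<lambda>t. max (t - a) 0))"
  proof (intro diff_mono add_right_mono mult_left_mono sum_mono L_one f0 A(3))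
    fix a assume "a \<in> A"
    then show "L (\<lambda>t. max (t - a) 0) \<le> (\<Sum>j\<in>K. max (s j - a) 0)"
      unfolding L using hinge_trace_le[OF fin W S V d Z A(2) top] by simp
  qed
  also have "\<dots> = L f" by (simp only: Lf)
  finally show ?thesis by (simp only: L)
qed

section \<open>Weak majorization and symmetric norms\<close>

lemma decreasing_enumeration:
  fixes c :: "'a::finite \<Rightarrow> real"
  obtains e where "bij_betw e {..<CARD('a)} UNIV"
    "\<And>i j. i \<le> j \<Longrightarrow> j < CARD('a) \<Longrightarrow> c (e j) \<le> c (e i)"
proof -
  obtain ys :: "'a list" where ys: "set ys = UNIV" "distinct ys" using finite_distinct_list[OF finite] by blast
  define xs where "xs = sort_key (\<lambda>i. - c i) ys"
  have xs: "set xs = UNIV" "distinct xs" "sorted (map (\<lambda>i. - c i) xs)" using ys by (simp_all add: xs_def)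
  then have len: "length xs = CARD('a)" by (metis distinct_card)
  have "bij_betw (\<lambda>i. xs ! i) {..<CARD('a)} UNIV"
    using xs len bij_betw_nth[of xs "{..<CARD('a)}" UNIV] by simp
  moreover have "c (xs ! j) \<le> c (xs ! i)" if "i \<le> j" "j < CARD('a)" for i j
    using sorted_nth_mono[OF xs(3) that(1)] that len by simp
  ultimately show ?thesis using that[of "\<lambda>i. xs ! i"] by blast
qed

text \<open>
Summation by parts, in the form that each partial sum of \<open>c\<^sub>j z\<^sub>j\<close> dominates the last coefficient times the partial
sum of the \<open>z\<^sub>j\<close>.
\<close>

lemma abel_sum_nonneg:
  fixes c z :: "nat \<Rightarrow> real"
  assumes c: "\<And>j. j < n \<Longrightarrow> 0 \<le> c j" "\<And>i j. i \<le> j \<Longrightarrow> j < n \<Longrightarrow> c j \<le> c i"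
    and z: "\<And>k. k \<le> n \<Longrightarrow> 0 \<le> (\<Sum>j<k. z j)"
  shows "0 \<le> (\<Sum>j<n. c j * z j)"
proof -
  have "c k * (\<Sum>j<Suc k. z j) \<le> (\<Sum>j<Suc k. c j * z j)" if "k < n" for k
    using that
  proof (induction k)
    case (Suc k)
    have "c (Suc k) * (\<Sum>j<Suc k. z j) \<le> c k * (\<Sum>j<Suc k. z j)"
      using c(2)[of k "Suc k"] z[of "Suc k"] Suc.prems by (intro mult_right_mono) auto
    with Suc show ?case by (simp add: algebra_simps)
  qed simp
  note claim = this
  show ?thesis
  proof (cases n)
    case (Suc m)
    have "0 \<le> c m * (\<Sum>j<Suc m. z j)" using c(1)[of m] z[of "Suc m"] Suc by simp
    also have "\<dots> \<le> (\<Sum>j<n. c j * z j)" using claim[of m] Suc by simp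
    finally show ?thesis .
  qed simp
qed

text \<open>
Choosing \<open>K\<close> to maximize the left sum shows that this is the usual comparison of the sums of the \<open>k\<close> largest values for
every \<open>k\<close>.
\<close>

definition weakly_majorized :: "('a::finite \<Rightarrow> real) \<Rightarrow> ('a \<Rightarrow> real) \<Rightarrow> bool" where
  "weakly_majorized x y \<longleftrightarrow> (\<forall>K. \<exists>J. card J = card K \<and> sum x K \<le> sum y J)"

text \<open>
Pairing the largest values of \<open>y\<close> with the largest values of \<open>c\<close> is optimal; the comparison is then
summation by parts.
\<close>

lemma weakly_majorized_permutation:
  fixes x y c :: "'a::finite \<Rightarrow> real"
  assumes maj: "weakly_majorized x y" and y: "\<And>i. 0 \<le> y i" and c: "\<And>i. 0 \<le> c i"
  obtains \<sigma> where "bij \<sigma>" "(\<Sum>i\<in>UNIV. c i * x i) \<le> (\<Sum>i\<in>UNIV. c i * y (\<sigma> i))"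
proof -
  let ?n = "CARD('a)"
  obtain e where e: "bij_betw e {..<?n} UNIV" "\<And>i j. i \<le> j \<Longrightarrow> j < ?n \<Longrightarrow> c (e j) \<le> c (e i)"
    using decreasing_enumeration by blast
  obtain p where p: "bij_betw p {..<?n} UNIV" "\<And>i j. i \<le> j \<Longrightarrow> j < ?n \<Longrightarrow> y (p j) \<le> y (p i)"
    using decreasing_enumeration by blast
  have "0 \<le> (\<Sum>j<k. y (p j) - x (e j))" if k: "k \<le> ?n" for k
  proof -
    have sub: "{..<k} \<subseteq> {..<?n}" using k by auto
    have inj: "inj_on e {..<k}" "inj_on p {..<k}"
      using e(1) p(1) sub by (auto simp: bij_betw_def intro: inj_on_subset)
    obtain J where J: "card J = card (e ` {..<k})" "sum x (e ` {..<k}) \<le> sum y J"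
      using maj unfolding weakly_majorized_def by blast
    have top: "top_set y (p ` {..<k})"
    proof -
      have "y l \<le> y (p j)" if "j < k" "l \<notin> p ` {..<k}" for j l
      proof -
        obtain i where "i < ?n" "l = p i" using p(1) unfolding bij_betw_def by (metis UNIV_I imageE lessThan_iff)
        then show ?thesis using p(2)[of j i] that by (metis imageI lessThan_iff not_le order.strict_trans1 less_imp_le)
      qed
      then show ?thesis by (auto simp: top_set_def)
    qed
    have cardJ: "card J = card (p ` {..<k})" using J(1) inj by (simp add: card_image)
    have "(\<Sum>l\<in>UNIV. y l * (if l \<in> J then 1 else 0)) \<le> sum y (p ` {..<k})"
      using cardJ by (intro weighted_sum_le_top_sum top y) (simp_all add: sum.If_cases)
    then have "sum y J \<le> sum y (p ` {..<k})" by (simp add: if_distrib sum.If_cases cong: if_cong)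
    then show ?thesis using J(2) inj by (simp add: sum.reindex sum_subtractf)
  qed
  then have "0 \<le> (\<Sum>j<?n. c (e j) * (y (p j) - x (e j)))"
    using c e(2) by (intro abel_sum_nonneg) auto
  then have le: "(\<Sum>j<?n. c (e j) * x (e j)) \<le> (\<Sum>j<?n. c (e j) * y (p j))"
    by (simp add: algebra_simps sum_subtractf)
  define \<sigma> where "\<sigma> = p \<circ> the_inv_into {..<?n} e"
  have "bij \<sigma>"
    unfolding \<sigma>_def using bij_betw_trans[OF bij_betw_the_inv_into[OF e(1)] p(1)] .
  moreover have "\<sigma> (e j) = p j" if "j < ?n" for j
    using e(1) that by (simp add: \<sigma>_def the_inv_into_f_f bij_betw_def)
  then have "(\<Sum>i\<in>UNIV. c i * y (\<sigma> i)) = (\<Sum>j<?n. c (e j) * y (p j))"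
    using sum.reindex_bij_betw[OF e(1), of "\<lambda>i. c i * y (\<sigma> i)"] by simp
  moreover have "(\<Sum>i\<in>UNIV. c i * x i) = (\<Sum>j<?n. c (e j) * x (e j))"
    using sum.reindex_bij_betw[OF e(1), of "\<lambda>i. c i * x i"] by simp
  ultimately show ?thesis using that le by metis
qed

definition signed_permutations :: "('n::finite \<Rightarrow> real) \<Rightarrow> (real^'n) set" where
  "signed_permutations y = (\<lambda>(\<epsilon>, \<sigma>). \<chi> i. (if \<epsilon> i then 1 else - 1) * y (\<sigma> i)) ` (UNIV \<times> {\<sigma>. bij \<sigma>})"

text \<open>
A hyperplane with normal \<open>c\<close> separating \<open>x\<close> from the hull would contradict the permutation found for the
weights \<open>|c|\<close>, once the signs of \<open>y\<close> are adapted to those of \<open>c\<close>.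
\<close>

lemma weakly_majorized_in_hull:
  fixes x y :: "'n::finite \<Rightarrow> real"
  assumes maj: "weakly_majorized x y" and x: "\<And>i. 0 \<le> x i" and y: "\<And>i. 0 \<le> y i"
  shows "(\<chi> i. x i) \<in> convex hull signed_permutations y"
proof (rule ccontr)
  assume "(\<chi> i. x i) \<notin> convex hull signed_permutations y"
  moreover have "closed (convex hull signed_permutations y)"
    by (intro compact_imp_closed finite_imp_compact_convex_hull) (simp add: signed_permutations_def)
  ultimately obtain c \<beta> where sep: "c \<bullet> (\<chi> i. x i) < \<beta>"
      "\<And>v. v \<in> convex hull signed_permutations y \<Longrightarrow> \<beta> < c \<bullet> v"
    using separating_hyperplane_closed_point[OF convex_convex_hull] by metis
  obtain \<sigma> where \<sigma>: "bij \<sigma>" "(\<Sum>i\<in>UNIV. \<bar>c $ i\<bar> * x i) \<le> (\<Sum>i\<in>UNIV. \<bar>c $ i\<bar> * y (\<sigma> i))"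
    using weakly_majorized_permutation[OF maj y, of "\<lambda>i. \<bar>c $ i\<bar>"] by auto
  define v :: "real^'n" where "v = (\<chi> i. (if c $ i \<le> 0 then 1 else - 1) * y (\<sigma> i))"
  have "v \<in> signed_permutations y"
    unfolding signed_permutations_def v_def using \<sigma>(1) by (intro image_eqI[of _ _ "(\<lambda>i. c $ i \<le> 0, \<sigma>)"]) auto
  then have "\<beta> < c \<bullet> v" by (intro sep hull_inc)
  also have "c \<bullet> v = - (\<Sum>i\<in>UNIV. \<bar>c $ i\<bar> * y (\<sigma> i))"
    unfolding inner_vec_def sum_negf[symmetric] by (intro sum.cong) (auto simp: v_def)
  also have "\<dots> \<le> (\<Sum>i\<in>UNIV. - \<bar>c $ i\<bar> * x i)" using \<sigma>(2) by (simp add: sum_negf)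
  also have "\<dots> \<le> (\<Sum>i\<in>UNIV. c $ i * x i)" by (intro sum_mono mult_right_mono x) auto
  also have "\<dots> = c \<bullet> (\<chi> i. x i)" by (simp add: inner_vec_def)
  finally show False using sep(1) by simp
qed

text \<open>
Signed permutations of diagonal entries are realized by multiplication with a permutation matrix \<open>P\<close>, its adjoint, and a
diagonal matrix \<open>E\<close> of signs, all of them unitary.
\<close>

lemma symmetric_norm_signed_permutation:
  fixes N :: "complex^'n^'n \<Rightarrow> real"
  assumes N: "symmetric_norm N" and v: "v \<in> signed_permutations y"
  shows "N (real_diag (\<lambda>i. v $ i)) = N (real_diag y)"
proof -
  obtain \<epsilon> \<sigma> where \<sigma>: "bij \<sigma>" and v_eq: "v = (\<chi> i. (if \<epsilon> i then 1 else - 1) * y (\<sigma> i))"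
    using v by (auto simp: signed_permutations_def)
  define E :: "complex^'n^'n" where "E = real_diag (\<lambda>i. if \<epsilon> i then 1 else - 1)"
  define P :: "complex^'n^'n" where "P = (\<chi> i j. if j = \<sigma> i then 1 else 0)"
  have inj: "\<sigma> i = \<sigma> j \<longleftrightarrow> i = j" for i j using \<sigma> by (metis bij_def injD)
  have P_nth: "P $ i $ k * z = (if k = \<sigma> i then z else 0)" for i k z by (simp add: P_def)
  have PP: "P ** conj_transpose P = mat 1"
    by (simp add: vec_eq_iff matrix_matrix_mult_def P_nth)
      (simp add: conj_transpose_nth P_def mat_def inj)
  then have P: "unitary_matrix P" by (simp add: unitary_matrix_def matrix_left_right_inverse)
  have "E ** E = mat 1"
    by (simp add: vec_eq_iff E_def real_diag_mult_left) (simp add: real_diag_def mat_def)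
  then have E: "unitary_matrix E" by (simp add: unitary_matrix_def E_def)
  have "P ** real_diag y ** conj_transpose P = real_diag (\<lambda>i. y (\<sigma> i))"
    unfolding matrix_mul_assoc[symmetric]
    by (simp add: vec_eq_iff matrix_matrix_mult_def[of P] P_nth real_diag_mult_left)
      (simp add: conj_transpose_nth P_def real_diag_def inj)
  moreover have "real_diag (\<lambda>i. v $ i) = E ** real_diag (\<lambda>i. y (\<sigma> i)) ** mat 1"
    by (simp add: vec_eq_iff E_def real_diag_mult_left) (simp add: v_eq real_diag_def)
  ultimately have "real_diag (\<lambda>i. v $ i) = (E ** P) ** real_diag y ** (conj_transpose P)"
    by (simp flip: matrix_mul_assoc)
  then show ?thesis
    using N unitary_mult[OF E P] unitary_conj_transpose[OF P] by (simp add: symmetric_norm_def)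
qed

lemma convex_norm_real_diag:
  fixes N :: "complex^'n^'n \<Rightarrow> real"
  assumes "matrix_norm N"
  shows "convex {v. N (real_diag (\<lambda>i. v $ i)) \<le> r}"
proof (rule convexI, clarify)
  fix v w :: "real^'n" and a b :: real
  assume v: "N (real_diag (\<lambda>i. v $ i)) \<le> r" and w: "N (real_diag (\<lambda>i. w $ i)) \<le> r"
    and ab: "0 \<le> a" "0 \<le> b" "a + b = 1"
  have scale: "N (map_matrix ((*) (complex_of_real c)) A) = c * N A" if "0 \<le> c" for c A
    using assms that by (simp add: matrix_norm_def)
  have "real_diag (\<lambda>i. (a *\<^sub>R v + b *\<^sub>R w) $ i)
      = map_matrix ((*) (complex_of_real a)) (real_diag (\<lambda>i. v $ i))
        + map_matrix ((*) (complex_of_real b)) (real_diag (\<lambda>i. w $ i))"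
    by (simp add: vec_eq_iff real_diag_def map_matrix_def)
  moreover have "N (A + B) \<le> N A + N B" for A B
    using assms by (simp add: matrix_norm_def)
  ultimately have "N (real_diag (\<lambda>i. (a *\<^sub>R v + b *\<^sub>R w) $ i))
      \<le> a * N (real_diag (\<lambda>i. v $ i)) + b * N (real_diag (\<lambda>i. w $ i))"
    by (simp only: scale[OF ab(1), symmetric] scale[OF ab(2), symmetric])
  also have "\<dots> \<le> a * r + b * r" using v w ab by (intro add_mono mult_left_mono)
  also have "\<dots> = r" using ab(3) by (simp flip: distrib_right)
  finally show "N (real_diag (\<lambda>i. (a *\<^sub>R v + b *\<^sub>R w) $ i)) \<le> r" .
qed

text \<open>
Ky Fan's dominance theorem, for positive semidefinite matrices. A symmetric norm sees only the
diagonal of eigenvalues, its sublevel set on diagonal matrices is convex, and that set contains the signed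
permutations of \<open>y\<close>.
\<close>

lemma ky_fan_dominance:
  assumes N: "symmetric_norm N"
    and U: "unitary_matrix U" and V: "unitary_matrix V"
    and x: "\<And>i. 0 \<le> x i" and y: "\<And>i. 0 \<le> y i" and maj: "weakly_majorized x y"
  shows "N (spectral_matrix U x) \<le> N (spectral_matrix V y)"
proof -
  have diag: "N (spectral_matrix U x) = N (real_diag x)" if "unitary_matrix U" for U x
    using N that unitary_conj_transpose[OF that] by (simp add: symmetric_norm_def spectral_matrix_def)
  have "convex hull signed_permutations y \<subseteq> {v. N (real_diag (\<lambda>i. v $ i)) \<le> N (real_diag y)}"
    using N symmetric_norm_signed_permutation[OF N]
    by (intro hull_minimal convex_norm_real_diag) (auto simp: symmetric_norm_def)
  with weakly_majorized_in_hull[OF maj x y]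
  have "N (real_diag (\<lambda>i. (\<chi> i. x i) $ i)) \<le> N (real_diag y)" by blast
  then show ?thesis by (simp add: diag U V)
qed

text \<open>
If \<open>f\<close> decreased from \<open>x\<close> to \<open>y\<close>, it would stay below the chord continued beyond \<open>y\<close> and become negative.
\<close>

lemma concave_nonneg_mono:
  fixes f :: "real \<Rightarrow> real"
  assumes f: "concave_on {0..} f" "\<And>x. 0 \<le> x \<Longrightarrow> 0 \<le> f x" and "0 \<le> x" "x \<le> y"
  shows "f x \<le> f y"
proof (rule ccontr)
  assume "\<not> f x \<le> f y"
  then have less: "f y < f x" by simp
  then have xy: "x < y" using assms(4) by (cases "x = y") auto
  \<comment> \<open>The point where the line through the values at \<open>x\<close> and \<open>y\<close> reaches \<open>-1\<close>.\<close>
  define z where "z = y + (y - x) * (f y + 1) / (f x - f y)"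
  have fy: "0 \<le> f y" using f(2) assms by simp
  have yz: "y \<le> z" using xy less fy by (simp add: z_def)
  have "(z - y) * f x + (y - x) * f z \<le> (z - x) * f y"
    by (rule concave_on_three_points[OF f(1)]) (use assms yz in auto)
  moreover have "0 \<le> (y - x) * f z" using f(2)[of z] assms yz by simp
  ultimately have "(z - y) * (f x - f y) \<le> (y - x) * f y" by (simp add: algebra_simps)
  moreover have "(z - y) * (f x - f y) = (y - x) * (f y + 1)" using less by (simp add: z_def)
  ultimately show False using xy by (simp add: algebra_simps)
qed

section \<open>The norm inequality\<close>

theorem theorem3p1:
  fixes A Z :: "nat \<Rightarrow> complex^'n^'n"
    and m :: nat
    and f :: "real \<Rightarrow> real"
    and N :: "complex^'n^'n \<Rightarrow> real"
  assumes "m \<ge> 1"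
    and "\<And>i. i \<in> {1..m} \<Longrightarrow> psd_matrix (A i)"
    and "\<And>i. i \<in> {1..m} \<Longrightarrow> expansive_matrix (Z i)"
    and "concave_on {0..} f"
    and "\<And>x. x \<ge> 0 \<Longrightarrow> f x \<ge> 0"
    and "symmetric_norm N"
  shows "N (matrix_fun f (\<Sum>i=1..m. conj_transpose (Z i) ** A i ** Z i))
       \<le> N (\<Sum>i=1..m. conj_transpose (Z i) ** matrix_fun f (A i) ** Z i)"
proof -
  let ?I = "{1..m}"
  have decomp: "\<exists>V d. unitary_matrix V \<and> B = spectral_matrix V d \<and> (\<forall>k. 0 \<le> d k)"
    if B: "psd_matrix B" for B :: "complex^'n^'n"
  proof -
    obtain V d where V: "unitary_matrix V" "B = spectral_matrix V d"
      using B hermitian_spectral_decomposition unfolding spectral_matrix_def psd_matrix_def by metis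
    then show ?thesis using B psd_spectral_iff[OF V(1)] by blast
  qed
  have "\<forall>i\<in>?I. \<exists>V d. unitary_matrix V \<and> A i = spectral_matrix V d \<and> (\<forall>k. 0 \<le> d k)"
    using decomp assms(2) by blast
  then obtain V d where V: "\<And>i. i \<in> ?I \<Longrightarrow> unitary_matrix (V i)"
    and A: "\<And>i. i \<in> ?I \<Longrightarrow> A i = spectral_matrix (V i) (d i)"
    and d: "\<And>i k. i \<in> ?I \<Longrightarrow> 0 \<le> d i k" by metis
  let ?S = "\<Sum>i\<in>?I. conj_transpose (Z i) ** spectral_matrix (V i) (d i) ** Z i"
  let ?Y = "\<Sum>i\<in>?I. conj_transpose (Z i) ** spectral_matrix (V i) (\<lambda>k. f (d i k)) ** Z i"
  have S_eq: "(\<Sum>i\<in>?I. conj_transpose (Z i) ** A i ** Z i) = ?S" using A by simp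
  have Y_eq: "(\<Sum>i\<in>?I. conj_transpose (Z i) ** matrix_fun f (A i) ** Z i) = ?Y"
    using A V by (simp add: matrix_fun_spectral)
  have "psd_matrix ?S" "psd_matrix ?Y"
    using V d assms(5) by (auto intro!: psd_sum psd_congruence simp: psd_spectral_iff)
  then obtain W s U y where W: "unitary_matrix W" "?S = spectral_matrix W s" "\<And>k. 0 \<le> s k"
    and U: "unitary_matrix U" "?Y = spectral_matrix U y" "\<And>k. 0 \<le> y k"
    using decomp by meson
  have "weakly_majorized (\<lambda>j. f (s j)) y"
    unfolding weakly_majorized_def
  proof
    fix L :: "'n set"
    have "card L \<le> CARD('n)" by (intro card_mono) auto
    then obtain K J where K: "card K = card L" "top_set s K" and J: "card J = card L" "top_set y J"
      using top_set_exists[of "card L"] by metis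
    have top: "top_set (\<lambda>j. f (s j)) K"
      using K(2) W(3) concave_nonneg_mono[OF assms(4,5)] by (auto simp: top_set_def)
    have "(\<Sum>j\<in>UNIV. f (s j) * (if j \<in> L then 1 else 0)) \<le> (\<Sum>j\<in>K. f (s j))"
      using K(1) assms(5) W(3) by (intro weighted_sum_le_top_sum top) (simp_all add: sum.If_cases)
    then have "(\<Sum>j\<in>L. f (s j)) \<le> (\<Sum>j\<in>K. f (s j))"
      by (simp add: if_distrib sum.If_cases cong: if_cong)
    also have "\<dots> \<le> (\<Sum>j\<in>K. \<Sum>i\<in>?I. column j W \<bullet>
        ((conj_transpose (Z i) ** spectral_matrix (V i) (\<lambda>k. f (d i k)) ** Z i) *v column j W))"
      using assms V d K(2) W by (intro concave_trace_ge) auto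
    also have "\<dots> = (\<Sum>j\<in>K. column j W \<bullet> (spectral_matrix U y *v column j W))"
      by (simp add: matrix_sum_vector inner_sum_right flip: U(2))
    also have "\<dots> \<le> sum y J"
      using J K(1) U(3) by (intro ky_fan_trace_le U(1) W(1)) auto
    finally show "\<exists>J. card J = card L \<and> (\<Sum>j\<in>L. f (s j)) \<le> sum y J" using J(1) by blast
  qed
  then have "N (spectral_matrix W (\<lambda>j. f (s j))) \<le> N (spectral_matrix U y)"
    using assms(5,6) W U by (intro ky_fan_dominance) auto
  then show ?thesis
    unfolding S_eq Y_eq W(2) U(2) matrix_fun_spectral[OF W(1)] .
qed

end
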